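(* Let $\mathcal T=(V,E)$ be a rooted, leafless, locally finite directed tree with root $\omega$, let $l=\deg\omega$, and suppose the adjacency operator $S_{\mathbb 1}\in\mathcal B(\ell^2(V))$ is a $2$-isometry. Suppose one of the following holds: (i) each vertex $u\neq\omega$ has degree $1$ or $l$; (ii) $l\ge2$ and exactly $l-1$ vertices of $\mathrm{Chi}(\omega)$ have degree $2$ (i.e. $l-1$ children of the root have degree $2$). Then: (1) the Cauchy dual $S_{\mathbb 1}'$ is a subnormal contraction; (2) $S_{\mathbb 1}$ satisfies the kernel condition iff $l=1$; (3) under (i), $S_{\mathbb 1}$ is a quasi-Brownian isometry, and it is a Brownian isometry iff $l=1$; (4) under (ii), $S_{\mathbb 1}$ is never a Brownian isometry, and it is a quasi-Brownian isometry iff $l=2$.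
   Context: A directed tree is a connected directed graph without circuits with each vertex having at most one parent; $\mathrm{Chi}(u)$ is the set of children, $\deg u=\#\mathrm{Chi}(u)$; leafless: all $\deg u\ge1$; locally finite: all $\deg u<\infty$. The adjacency operator is $(S_{\mathbb 1}f)(v)=f(\mathrm{par}(v))$ for non-root $v$, $0$ at the root. $2$-isometry: $I-2T^*T+T^{*2}T^2=0$; Cauchy dual $T'=T(T^*T)^{-1}$. Kernel condition: $T^*T(\ker T^* )\subseteq\ker T^*$. With $\Delta_T=T^*T-I$: a quasi-Brownian isometry is a $2$-isometry with $\Delta_TT=\Delta_T^{1/2}T\Delta_T^{1/2}$; a Brownian isometry is a $2$-isometry with $\Delta_T\Delta_{T^*}\Delta_T=0$. *)

theory Defs
  imports "HOL-Analysis.Analysis"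
begin

section \<open>The Hilbert space ell^2 over a type, and bounded operators on it\<close>

text \<open>Vectors of ell^2(A) are complex-valued functions on A with square-summable modulus.
  Operators are represented as functions on all of A \<Rightarrow> complex; only their
  behaviour on ell2 matters, and operator identities are stated on ell2 only.\<close>

definition ell2 :: "('a \<Rightarrow> complex) set" where
  "ell2 = {f. (\<lambda>x. (cmod (f x))^2) summable_on UNIV}"

definition ell2_inner :: "('a \<Rightarrow> complex) \<Rightarrow> ('a \<Rightarrow> complex) \<Rightarrow> complex" where
  "ell2_inner f g = (\<Sum>\<^sub>\<infinity>x. cnj (f x) * g x)"

definition ell2_norm :: "('a \<Rightarrow> complex) \<Rightarrow> real" where
  "ell2_norm f = sqrt (\<Sum>\<^sub>\<infinity>x. (cmod (f x))^2)"

definition bounded_op :: "(('a \<Rightarrow> complex) \<Rightarrow> ('b \<Rightarrow> complex)) \<Rightarrow> bool" where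
  "bounded_op T \<longleftrightarrow>
     (\<forall>f\<in>ell2. T f \<in> ell2) \<and>
     (\<forall>f\<in>ell2. \<forall>g\<in>ell2. T (\<lambda>x. f x + g x) = (\<lambda>y. T f y + T g y)) \<and>
     (\<forall>f\<in>ell2. \<forall>c. T (\<lambda>x. c * f x) = (\<lambda>y. c * T f y)) \<and>
     (\<exists>C. \<forall>f\<in>ell2. ell2_norm (T f) \<le> C * ell2_norm f)"

text \<open>Equality of operators (on ell2).\<close>
definition op_eq :: "(('a \<Rightarrow> complex) \<Rightarrow> ('b \<Rightarrow> complex)) \<Rightarrow> (('a \<Rightarrow> complex) \<Rightarrow> ('b \<Rightarrow> complex)) \<Rightarrow> bool" where
  "op_eq T S \<longleftrightarrow> (\<forall>f\<in>ell2. T f = S f)"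

text \<open>The Hilbert space adjoint.\<close>
definition adj :: "(('a \<Rightarrow> complex) \<Rightarrow> ('b \<Rightarrow> complex)) \<Rightarrow> (('b \<Rightarrow> complex) \<Rightarrow> ('a \<Rightarrow> complex))" where
  "adj T = (SOME A. (\<forall>g\<in>ell2. A g \<in> ell2) \<and>
                    (\<forall>f\<in>ell2. \<forall>g\<in>ell2. ell2_inner (T f) g = ell2_inner f (A g)))"

text \<open>Inverse of a (bounded, invertible) operator.\<close>
definition op_inv :: "(('a \<Rightarrow> complex) \<Rightarrow> ('a \<Rightarrow> complex)) \<Rightarrow> (('a \<Rightarrow> complex) \<Rightarrow> ('a \<Rightarrow> complex))" where
  "op_inv A = (SOME B. bounded_op B \<and> op_eq (A \<circ> B) id \<and> op_eq (B \<circ> A) id)"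

definition positive_op :: "(('a \<Rightarrow> complex) \<Rightarrow> ('a \<Rightarrow> complex)) \<Rightarrow> bool" where
  "positive_op A \<longleftrightarrow> bounded_op A \<and>
     (\<forall>f\<in>ell2. ell2_inner f (A f) \<in> \<real> \<and> 0 \<le> Re (ell2_inner f (A f)))"

text \<open>The (unique) positive square root of a positive operator.\<close>
definition op_sqrt :: "(('a \<Rightarrow> complex) \<Rightarrow> ('a \<Rightarrow> complex)) \<Rightarrow> (('a \<Rightarrow> complex) \<Rightarrow> ('a \<Rightarrow> complex))" where
  "op_sqrt A = (SOME R. positive_op R \<and> op_eq (R \<circ> R) A)"

section \<open>Operator-theoretic notions\<close>

text \<open>2-isometry: I - 2 T*T + T*^2 T^2 = 0.\<close>
definition two_isometry :: "(('a \<Rightarrow> complex) \<Rightarrow> ('a \<Rightarrow> complex)) \<Rightarrow> bool" where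
  "two_isometry T \<longleftrightarrow> bounded_op T \<and>
     op_eq (\<lambda>f x. f x - 2 * adj T (T f) x + adj T (adj T (T (T f))) x) (\<lambda>f x. 0)"

text \<open>Cauchy dual T' = T (T*T)^{-1}.\<close>
definition cauchy_dual :: "(('a \<Rightarrow> complex) \<Rightarrow> ('a \<Rightarrow> complex)) \<Rightarrow> (('a \<Rightarrow> complex) \<Rightarrow> ('a \<Rightarrow> complex))" where
  "cauchy_dual T = T \<circ> op_inv (adj T \<circ> T)"

definition contraction :: "(('a \<Rightarrow> complex) \<Rightarrow> ('a \<Rightarrow> complex)) \<Rightarrow> bool" where
  "contraction T \<longleftrightarrow> bounded_op T \<and> (\<forall>f\<in>ell2. ell2_norm (T f) \<le> ell2_norm f)"

definition normal_op :: "(('a \<Rightarrow> complex) \<Rightarrow> ('a \<Rightarrow> complex)) \<Rightarrow> bool" where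
  "normal_op N \<longleftrightarrow> bounded_op N \<and> op_eq (adj N \<circ> N) (N \<circ> adj N)"

text \<open>Subnormal: T has a normal extension, i.e. there is an isometric embedding J of
  ell2(V) into a Hilbert space K and a normal operator N on K with N J = J T.
  The extension space K is taken to be ell2(V \<times> nat) (see NOTES.md, FIDELITY).\<close>
definition subnormal :: "(('v \<Rightarrow> complex) \<Rightarrow> ('v \<Rightarrow> complex)) \<Rightarrow> bool" where
  "subnormal T \<longleftrightarrow> bounded_op T \<and>
     (\<exists>(J :: ('v \<Rightarrow> complex) \<Rightarrow> ('v \<times> nat \<Rightarrow> complex)) N.
        bounded_op J \<and> (\<forall>f\<in>ell2. ell2_norm (J f) = ell2_norm f) \<and>
        normal_op N \<and> (\<forall>f\<in>ell2. N (J f) = J (T f)))"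

text \<open>Kernel condition: T*T (ker T*) \<subseteq> ker T*.\<close>
definition kernel_condition :: "(('a \<Rightarrow> complex) \<Rightarrow> ('a \<Rightarrow> complex)) \<Rightarrow> bool" where
  "kernel_condition T \<longleftrightarrow>
     (\<forall>f\<in>ell2. adj T f = (\<lambda>x. 0) \<longrightarrow> adj T (adj T (T f)) = (\<lambda>x. 0))"

text \<open>Delta_T = T*T - I.\<close>
definition Delta :: "(('a \<Rightarrow> complex) \<Rightarrow> ('a \<Rightarrow> complex)) \<Rightarrow> (('a \<Rightarrow> complex) \<Rightarrow> ('a \<Rightarrow> complex))" where
  "Delta T = (\<lambda>f x. adj T (T f) x - f x)"

definition quasi_brownian :: "(('a \<Rightarrow> complex) \<Rightarrow> ('a \<Rightarrow> complex)) \<Rightarrow> bool" where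
  "quasi_brownian T \<longleftrightarrow> two_isometry T \<and>
     op_eq (Delta T \<circ> T) (op_sqrt (Delta T) \<circ> T \<circ> op_sqrt (Delta T))"

text \<open>Brownian: Delta_T Delta_{T*} Delta_T = 0, where Delta_{T*} = T T* - I.\<close>
definition brownian :: "(('a \<Rightarrow> complex) \<Rightarrow> ('a \<Rightarrow> complex)) \<Rightarrow> bool" where
  "brownian T \<longleftrightarrow> two_isometry T \<and>
     op_eq (Delta T \<circ> (\<lambda>f x. T (adj T f) x - f x) \<circ> Delta T) (\<lambda>f x. 0)"

section \<open>Directed trees (vertex set = the whole type 'v)\<close>

definition directed_tree :: "('v \<times> 'v) set \<Rightarrow> bool" where
  "directed_tree E \<longleftrightarrow>
     (\<forall>v. (v, v) \<notin> E\<^sup>+) \<and>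
     (\<forall>u w v. (u, v) \<in> E \<longrightarrow> (w, v) \<in> E \<longrightarrow> u = w) \<and>
     (\<forall>u v. (u, v) \<in> (E \<union> E\<inverse>)\<^sup>*)"

definition is_root :: "('v \<times> 'v) set \<Rightarrow> 'v \<Rightarrow> bool" where
  "is_root E \<omega> \<longleftrightarrow> \<not> (\<exists>u. (u, \<omega>) \<in> E)"

definition Chi :: "('v \<times> 'v) set \<Rightarrow> 'v \<Rightarrow> 'v set" where
  "Chi E u = {v. (u, v) \<in> E}"

definition deg :: "('v \<times> 'v) set \<Rightarrow> 'v \<Rightarrow> nat" where
  "deg E u = card (Chi E u)"

definition leafless :: "('v \<times> 'v) set \<Rightarrow> bool" where
  "leafless E \<longleftrightarrow> (\<forall>u. Chi E u \<noteq> {})"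

definition locally_finite :: "('v \<times> 'v) set \<Rightarrow> bool" where
  "locally_finite E \<longleftrightarrow> (\<forall>u. finite (Chi E u))"

definition par :: "('v \<times> 'v) set \<Rightarrow> 'v \<Rightarrow> 'v" where
  "par E v = (THE u. (u, v) \<in> E)"

text \<open>Adjacency operator S_1: (S_1 f)(v) = f(par v) for non-root v, 0 at the root.\<close>
definition adjacency_op :: "('v \<times> 'v) set \<Rightarrow> ('v \<Rightarrow> complex) \<Rightarrow> ('v \<Rightarrow> complex)" where
  "adjacency_op E f = (\<lambda>v. if \<exists>u. (u, v) \<in> E then f (par E v) else 0)"

end

theory Submission
  imports Defs
begin

text \<open>Write \<open>e(u) = deg u - 1\<close>. As \<open>S*S\<close> is multiplication by \<open>deg\<close> for the adjacency operator
  \<open>S\<close>, being a 2-isometry means that \<open>e\<close> is conserved along the tree: the children of \<open>u\<close> have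
  total excess \<open>e(u)\<close>. The kernel condition and the Brownian and quasi-Brownian identities thereby reduce to conditions on the degrees.

  The Cauchy dual \<open>T\<close> is the weighted shift with weight \<open>1 / deg\<close> of the parent, and \<open>T*\<^sup>n T\<^sup>n\<close> is
  diagonal. In both cases its entries are moments of measures on at most three common atoms \<open>t\<^sub>k\<close>,
  with masses \<open>p\<^sub>k(u)\<close> that below the root are affine in \<open>e(u)\<close>. Then
  \<open>f \<mapsto> (sqrt p\<^sub>k f)\<^sub>k\<close> is an isometry which intertwines \<open>T\<close> with the direct sum of
  \<open>sqrt t\<^sub>k V\<^sub>k\<close>, where each \<open>V\<^sub>k\<close> is an isometry of the subspace carried by \<open>p\<^sub>k > 0\<close>; a
  unitary extension of every \<open>V\<^sub>k\<close> yields the normal extension of \<open>T\<close>.\<close>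

section \<open>Square-summable functions\<close>

lemma ell2_norm_nonneg [simp]: "ell2_norm f \<ge> 0"
  by (simp add: ell2_norm_def infsum_nonneg)

lemma ell2_norm_sq: "(ell2_norm f)\<^sup>2 = (\<Sum>\<^sub>\<infinity>x. (cmod (f x))\<^sup>2)"
  by (simp add: ell2_norm_def infsum_nonneg)

lemma has_sum_imp_ell2:
  assumes "((\<lambda>x. (cmod (f x))\<^sup>2) has_sum S) UNIV"
  shows "f \<in> ell2" "(ell2_norm f)\<^sup>2 = S"
  using assms by (auto simp: ell2_def ell2_norm_sq infsumI summable_on_def)

lemma ell2_has_sum: "f \<in> ell2 \<Longrightarrow> ((\<lambda>x. (cmod (f x))\<^sup>2) has_sum (ell2_norm f)\<^sup>2) UNIV"
  by (simp add: ell2_def ell2_norm_sq)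

lemma ell2_dominated:
  assumes "S summable_on UNIV" "\<And>x. (cmod (f x))\<^sup>2 \<le> S x"
  shows "f \<in> ell2" "(ell2_norm f)\<^sup>2 \<le> infsum S UNIV"
proof -
  show "f \<in> ell2" unfolding ell2_def mem_Collect_eq
    by (rule summable_on_comparison_test[OF assms(1)]) (use assms in auto)
  then show "(ell2_norm f)\<^sup>2 \<le> infsum S UNIV"
    unfolding ell2_norm_sq using assms by (intro infsum_mono) (simp_all add: ell2_def)
qed

lemma ell2_zero [simp]: "(\<lambda>x. 0) \<in> ell2"
  by (simp add: ell2_def)

lemma cmod_add_sq_le: "(cmod (a + b))\<^sup>2 \<le> 2 * (cmod a)\<^sup>2 + 2 * (cmod b)\<^sup>2"
proof -
  have "(cmod (a + b))\<^sup>2 \<le> (cmod a + cmod b)\<^sup>2"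
    by (simp add: norm_triangle_ineq)
  also have "\<dots> \<le> 2 * (cmod a)\<^sup>2 + 2 * (cmod b)\<^sup>2"
    using sum_squares_ge_zero[of "cmod a - cmod b" 0] by (simp add: power2_eq_square algebra_simps)
  finally show ?thesis .
qed

lemma ell2_add:
  assumes "f \<in> ell2" "g \<in> ell2"
  shows "(\<lambda>x. f x + g x) \<in> ell2"
    and "(ell2_norm (\<lambda>x. f x + g x))\<^sup>2 \<le> 2 * (ell2_norm f)\<^sup>2 + 2 * (ell2_norm g)\<^sup>2"
proof -
  let ?S = "\<lambda>x. 2 * (cmod (f x))\<^sup>2 + 2 * (cmod (g x))\<^sup>2"
  have S: "(?S has_sum 2 * (ell2_norm f)\<^sup>2 + 2 * (ell2_norm g)\<^sup>2) UNIV"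
    by (intro has_sum_add has_sum_cmult_right ell2_has_sum assms)
  note D = ell2_dominated[of ?S, OF has_sum_imp_summable[OF S] cmod_add_sq_le]
  show "(\<lambda>x. f x + g x) \<in> ell2" by (rule D(1))
  show "(ell2_norm (\<lambda>x. f x + g x))\<^sup>2 \<le> 2 * (ell2_norm f)\<^sup>2 + 2 * (ell2_norm g)\<^sup>2"
    using D(2) infsumI[OF S] by simp
qed

lemma ell2_scale:
  assumes "f \<in> ell2"
  shows "(\<lambda>x. c * f x) \<in> ell2" and "ell2_norm (\<lambda>x. c * f x) = cmod c * ell2_norm f"
proof -
  have "((\<lambda>x. (cmod (c * f x))\<^sup>2) has_sum (cmod c)\<^sup>2 * (ell2_norm f)\<^sup>2) UNIV"
    unfolding norm_mult power_mult_distrib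
    by (intro has_sum_cmult_right ell2_has_sum assms)
  note * = has_sum_imp_ell2[OF this]
  show "(\<lambda>x. c * f x) \<in> ell2" by (rule *)
  show "ell2_norm (\<lambda>x. c * f x) = cmod c * ell2_norm f"
    using *(2) by (rule_tac power2_eq_imp_eq) (simp_all add: power_mult_distrib)
qed

lemma ell2_diff: "f \<in> ell2 \<Longrightarrow> g \<in> ell2 \<Longrightarrow> (\<lambda>x. f x - g x) \<in> ell2"
  using ell2_add(1)[of f "\<lambda>x. -1 * g x"] ell2_scale(1)[of g "-1"] by simp

lemma ell2_inner_summable:
  assumes "f \<in> ell2" "g \<in> ell2"
  shows "(\<lambda>x. cnj (f x) * g x) summable_on UNIV"
proof (rule abs_summable_summable, rule summable_on_comparison_test)
  show "(\<lambda>x. (cmod (f x))\<^sup>2 + (cmod (g x))\<^sup>2) summable_on UNIV"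
    using assms by (intro summable_on_add) (auto simp: ell2_def)
  show "norm (cnj (f x) * g x) \<le> (cmod (f x))\<^sup>2 + (cmod (g x))\<^sup>2" for x
  proof -
    have "2 * (cmod (f x) * cmod (g x)) \<le> (cmod (f x))\<^sup>2 + (cmod (g x))\<^sup>2"
      using sum_squares_ge_zero[of "cmod (f x) - cmod (g x)" 0]
      by (simp add: power2_eq_square algebra_simps)
    moreover have "0 \<le> cmod (f x) * cmod (g x)" by simp
    ultimately have "cmod (f x) * cmod (g x) \<le> (cmod (f x))\<^sup>2 + (cmod (g x))\<^sup>2" by linarith
    then show ?thesis by (simp add: norm_mult)
  qed
qed simp

lemma ell2_inner_cnj: "ell2_inner g f = cnj (ell2_inner f g)"
  unfolding ell2_inner_def infsum_cnj[symmetric] by (intro infsum_cong) simp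

lemma ell2_inner_add_right:
  assumes "f \<in> ell2" "g \<in> ell2" "h \<in> ell2"
  shows "ell2_inner f (\<lambda>x. g x + h x) = ell2_inner f g + ell2_inner f h"
  unfolding ell2_inner_def
  using infsum_add[OF ell2_inner_summable[OF assms(1,2)] ell2_inner_summable[OF assms(1,3)]]
  by (simp add: algebra_simps)

lemma ell2_inner_scale_right: "ell2_inner f (\<lambda>x. c * g x) = c * ell2_inner f g"
  unfolding ell2_inner_def infsum_cmult_right'[symmetric] by (intro infsum_cong) simp

lemma ell2_inner_add_left:
  assumes "f \<in> ell2" "g \<in> ell2" "h \<in> ell2"
  shows "ell2_inner (\<lambda>x. g x + h x) f = ell2_inner g f + ell2_inner h f"
  using ell2_inner_add_right[OF assms]
  by (simp add: ell2_inner_cnj[of _ f] del: complex_cnj_cnj flip: complex_cnj_add)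

lemma ell2_inner_scale_left: "ell2_inner (\<lambda>x. c * g x) f = cnj c * ell2_inner g f"
  using ell2_inner_scale_right[of f c g] by (simp add: ell2_inner_cnj[of _ f])

lemma ell2_inner_self:
  assumes "f \<in> ell2"
  shows "ell2_inner f f = of_real ((ell2_norm f)\<^sup>2)"
proof -
  have "((\<lambda>x. cnj (f x) * f x) has_sum of_real ((ell2_norm f)\<^sup>2)) UNIV"
    using has_sum_of_real[OF ell2_has_sum[OF assms], where 'a = complex]
    by (simp only: complex_norm_square mult.commute)
  then show ?thesis unfolding ell2_inner_def by (rule infsumI)
qed

lemma ell2_norm_eq_0D:
  assumes "f \<in> ell2" "ell2_norm f = 0"
  shows "f x = 0"
proof -
  have "(cmod (f x))\<^sup>2 = 0"
  proof (rule nonneg_infsum_le_0D[where f = "\<lambda>x. (cmod (f x))\<^sup>2" and A = UNIV])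
    show "(\<Sum>\<^sub>\<infinity>x. (cmod (f x))\<^sup>2) \<le> 0"
      using ell2_norm_sq[of f] assms(2) by simp
  qed (use assms in \<open>auto simp: ell2_def\<close>)
  then show ?thesis by simp
qed

definition ell2_unit :: "'a \<Rightarrow> 'a \<Rightarrow> complex" where
  "ell2_unit a = (\<lambda>x. if x = a then 1 else 0)"

lemma ell2_finite_support: "finite {x. f x \<noteq> 0} \<Longrightarrow> f \<in> ell2"
  unfolding ell2_def mem_Collect_eq by (rule finite_nonzero_values_imp_summable_on) simp

lemma ell2_unit_in [simp]: "ell2_unit a \<in> ell2"
  by (rule ell2_finite_support) (auto simp: ell2_unit_def)

lemma ell2_inner_unit: "ell2_inner (ell2_unit a) g = g a"
proof -
  have "ell2_inner (ell2_unit a) g = (\<Sum>\<^sub>\<infinity>x\<in>{a}. g x)"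
    unfolding ell2_inner_def by (rule infsum_cong_neutral) (auto simp: ell2_unit_def)
  then show ?thesis by simp
qed

lemma ell2_norm_unit: "ell2_norm (ell2_unit a) = 1"
proof -
  have "complex_of_real ((ell2_norm (ell2_unit a))\<^sup>2) = of_real 1"
    using ell2_inner_self[OF ell2_unit_in[of a]] ell2_inner_unit[of a "ell2_unit a"]
    by (simp add: ell2_unit_def)
  then show ?thesis
    by (rule_tac power2_eq_imp_eq) (simp_all only: of_real_eq_iff, simp_all)
qed

section \<open>Bounded operators and adjoints\<close>

lemma bounded_opI:
  assumes "\<And>f. f \<in> ell2 \<Longrightarrow> T f \<in> ell2"
    and "\<And>f g y. f \<in> ell2 \<Longrightarrow> g \<in> ell2 \<Longrightarrow> T (\<lambda>x. f x + g x) y = T f y + T g y"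
    and "\<And>f c y. f \<in> ell2 \<Longrightarrow> T (\<lambda>x. c * f x) y = c * T f y"
    and "\<And>f. f \<in> ell2 \<Longrightarrow> (ell2_norm (T f))\<^sup>2 \<le> C * (ell2_norm f)\<^sup>2"
  shows "bounded_op T"
proof -
  have "ell2_norm (T f) \<le> sqrt \<bar>C\<bar> * ell2_norm f" if "f \<in> ell2" for f
  proof (rule power2_le_imp_le)
    have "(ell2_norm (T f))\<^sup>2 \<le> \<bar>C\<bar> * (ell2_norm f)\<^sup>2"
      using assms(4)[OF that] by (smt (verit) mult_right_mono zero_le_power2)
    then show "(ell2_norm (T f))\<^sup>2 \<le> (sqrt \<bar>C\<bar> * ell2_norm f)\<^sup>2"
      by (simp add: power_mult_distrib)
  qed simp
  then show ?thesis unfolding bounded_op_def using assms(1-3) by blast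
qed

lemma bounded_op_in: "bounded_op T \<Longrightarrow> f \<in> ell2 \<Longrightarrow> T f \<in> ell2"
  by (simp add: bounded_op_def)

lemma bounded_op_add:
  "bounded_op T \<Longrightarrow> f \<in> ell2 \<Longrightarrow> g \<in> ell2 \<Longrightarrow> T (\<lambda>x. f x + g x) = (\<lambda>y. T f y + T g y)"
  by (simp add: bounded_op_def)

lemma bounded_op_scale: "bounded_op T \<Longrightarrow> f \<in> ell2 \<Longrightarrow> T (\<lambda>x. c * f x) = (\<lambda>y. c * T f y)"
  by (simp add: bounded_op_def)

lemma bounded_op_diff:
  assumes "bounded_op T" "f \<in> ell2" "g \<in> ell2"
  shows "T (\<lambda>x. f x - g x) = (\<lambda>y. T f y - T g y)"
  using bounded_op_add[OF assms(1,2) ell2_scale(1)[OF assms(3), of "-1"]]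
    bounded_op_scale[OF assms(1,3), of "-1"] by simp

lemma bounded_op_bound:
  assumes "bounded_op T"
  obtains C where "C \<ge> 0" "\<And>f. f \<in> ell2 \<Longrightarrow> (ell2_norm (T f))\<^sup>2 \<le> C * (ell2_norm f)\<^sup>2"
proof -
  obtain C where C: "\<And>f. f \<in> ell2 \<Longrightarrow> ell2_norm (T f) \<le> C * ell2_norm f"
    using assms unfolding bounded_op_def by blast
  show ?thesis
  proof
    show "C\<^sup>2 \<ge> 0" by simp
    show "(ell2_norm (T f))\<^sup>2 \<le> C\<^sup>2 * (ell2_norm f)\<^sup>2" if "f \<in> ell2" for f
      using power_mono[OF C[OF that], of 2] by (simp add: power_mult_distrib)
  qed
qed

lemma bounded_op_cong:
  assumes "bounded_op T" "op_eq T S"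
  shows "bounded_op S"
proof -
  have eq: "S f = T f" if "f \<in> ell2" for f using assms(2) that by (simp add: op_eq_def)
  obtain C where C: "\<And>f. f \<in> ell2 \<Longrightarrow> (ell2_norm (T f))\<^sup>2 \<le> C * (ell2_norm f)\<^sup>2"
    using bounded_op_bound[OF assms(1)] by metis
  show ?thesis
    by (rule bounded_opI[where C = C])
      (simp_all add: eq C ell2_add ell2_scale bounded_op_in[OF assms(1)] bounded_op_add[OF assms(1)]
        bounded_op_scale[OF assms(1)])
qed

definition adjoint_pair ::
    "(('a \<Rightarrow> complex) \<Rightarrow> ('b \<Rightarrow> complex)) \<Rightarrow> (('b \<Rightarrow> complex) \<Rightarrow> ('a \<Rightarrow> complex)) \<Rightarrow> bool" where
  "adjoint_pair T A \<longleftrightarrow> bounded_op T \<and> bounded_op A \<and>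
     (\<forall>f\<in>ell2. \<forall>g\<in>ell2. ell2_inner (T f) g = ell2_inner f (A g))"

lemma adjoint_pairD:
  assumes "adjoint_pair T A"
  shows "bounded_op T" "bounded_op A"
    and "f \<in> ell2 \<Longrightarrow> g \<in> ell2 \<Longrightarrow> ell2_inner (T f) g = ell2_inner f (A g)"
  using assms by (auto simp: adjoint_pair_def)

lemma adjoint_pair_sym: "adjoint_pair T A \<Longrightarrow> adjoint_pair A T"
  unfolding adjoint_pair_def by (auto simp: ell2_inner_cnj[of "A _"] ell2_inner_cnj[of _ "T _"])

lemma adj_eq:
  assumes "adjoint_pair T A" "g \<in> ell2"
  shows "adj T g = A g"
proof -
  let ?P = "\<lambda>A. (\<forall>g\<in>ell2. A g \<in> ell2) \<and>
    (\<forall>f\<in>ell2. \<forall>g\<in>ell2. ell2_inner (T f) g = ell2_inner f (A g))"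
  have PA: "?P A" using assms(1) by (auto simp: adjoint_pair_def bounded_op_in)
  then have "?P (adj T)" unfolding adj_def by (rule someI[of ?P])
  then have "ell2_inner (ell2_unit x) (adj T g) = ell2_inner (ell2_unit x) (A g)" for x
    using PA assms(2) ell2_unit_in[of x] by auto
  then show ?thesis by (auto simp: ell2_inner_unit)
qed

lemma bounded_op_comp:
  assumes "bounded_op T" "bounded_op S"
  shows "bounded_op (\<lambda>f. T (S f))"
proof -
  obtain C where C: "C \<ge> 0" "\<And>f. f \<in> ell2 \<Longrightarrow> (ell2_norm (T f))\<^sup>2 \<le> C * (ell2_norm f)\<^sup>2"
    using bounded_op_bound[OF assms(1)] by blast
  obtain D where D: "D \<ge> 0" "\<And>f. f \<in> ell2 \<Longrightarrow> (ell2_norm (S f))\<^sup>2 \<le> D * (ell2_norm f)\<^sup>2"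
    using bounded_op_bound[OF assms(2)] by blast
  show ?thesis
  proof (rule bounded_opI)
    show "(ell2_norm (T (S f)))\<^sup>2 \<le> (C * D) * (ell2_norm f)\<^sup>2" if "f \<in> ell2" for f
    proof -
      have "(ell2_norm (T (S f)))\<^sup>2 \<le> C * (ell2_norm (S f))\<^sup>2"
        using C(2) bounded_op_in[OF assms(2) that] by blast
      also have "\<dots> \<le> C * (D * (ell2_norm f)\<^sup>2)" using D(2)[OF that] C(1) by (rule mult_left_mono)
      finally show ?thesis by (simp add: mult.assoc)
    qed
  qed (use assms in \<open>auto simp: bounded_op_in bounded_op_add bounded_op_scale\<close>)
qed

lemma bounded_op_sum2:
  assumes "bounded_op T" "bounded_op S"
  shows "bounded_op (\<lambda>f x. T f x + S f x)"
proof -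
  obtain C where C: "C \<ge> 0" "\<And>f. f \<in> ell2 \<Longrightarrow> (ell2_norm (T f))\<^sup>2 \<le> C * (ell2_norm f)\<^sup>2"
    using bounded_op_bound[OF assms(1)] by blast
  obtain D where D: "D \<ge> 0" "\<And>f. f \<in> ell2 \<Longrightarrow> (ell2_norm (S f))\<^sup>2 \<le> D * (ell2_norm f)\<^sup>2"
    using bounded_op_bound[OF assms(2)] by blast
  show ?thesis
  proof (rule bounded_opI)
    show "(ell2_norm (\<lambda>x. T f x + S f x))\<^sup>2 \<le> (2 * C + 2 * D) * (ell2_norm f)\<^sup>2" if "f \<in> ell2" for f
      using ell2_add(2)[OF bounded_op_in[OF assms(1) that] bounded_op_in[OF assms(2) that]]
        C(2)[OF that] D(2)[OF that] by (simp add: algebra_simps)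
  qed (use assms in \<open>auto simp: bounded_op_in bounded_op_add bounded_op_scale ell2_add algebra_simps\<close>)
qed

lemma bounded_op_smult:
  assumes "bounded_op T"
  shows "bounded_op (\<lambda>f x. c * T f x)"
proof -
  obtain C where C: "\<And>f. f \<in> ell2 \<Longrightarrow> (ell2_norm (T f))\<^sup>2 \<le> C * (ell2_norm f)\<^sup>2"
    using bounded_op_bound[OF assms] by metis
  show ?thesis
  proof (rule bounded_opI)
    show "(ell2_norm (\<lambda>x. c * T f x))\<^sup>2 \<le> ((cmod c)\<^sup>2 * C) * (ell2_norm f)\<^sup>2" if "f \<in> ell2" for f
      using mult_left_mono[OF C[OF that], of "(cmod c)\<^sup>2"]
      by (simp add: ell2_scale bounded_op_in[OF assms that] power_mult_distrib mult.assoc)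
  qed (use assms in \<open>auto simp: bounded_op_in bounded_op_add bounded_op_scale ell2_scale algebra_simps\<close>)
qed

lemma adjoint_pair_comp:
  assumes "adjoint_pair T A" "adjoint_pair S B"
  shows "adjoint_pair (\<lambda>f. T (S f)) (\<lambda>g. B (A g))"
  using assms by (auto simp: adjoint_pair_def bounded_op_comp bounded_op_in)

lemma adjoint_pair_add:
  assumes "adjoint_pair T A" "adjoint_pair S B"
  shows "adjoint_pair (\<lambda>f x. T f x + S f x) (\<lambda>g x. A g x + B g x)"
  using assms by (auto simp: adjoint_pair_def bounded_op_sum2 bounded_op_in
      ell2_inner_add_left ell2_inner_add_right)

lemma adjoint_pair_scale:
  assumes "adjoint_pair T A"
  shows "adjoint_pair (\<lambda>f x. of_real c * T f x) (\<lambda>g x. of_real c * A g x)"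
  using assms by (auto simp: adjoint_pair_def bounded_op_smult
      ell2_inner_scale_left ell2_inner_scale_right)

definition diag_op :: "('a \<Rightarrow> real) \<Rightarrow> ('a \<Rightarrow> complex) \<Rightarrow> ('a \<Rightarrow> complex)" where
  "diag_op d f = (\<lambda>x. of_real (d x) * f x)"

lemma diag_op_ell2:
  assumes "\<And>x. \<bar>d x\<bar> \<le> C" "f \<in> ell2"
  shows "diag_op d f \<in> ell2" "(ell2_norm (diag_op d f))\<^sup>2 \<le> C\<^sup>2 * (ell2_norm f)\<^sup>2"
proof -
  have le: "(cmod (diag_op d f x))\<^sup>2 \<le> C\<^sup>2 * (cmod (f x))\<^sup>2" for x
    using power_mono[OF assms(1)[of x], of 2]
    by (simp add: diag_op_def norm_mult power_mult_distrib mult_right_mono)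
  have S: "((\<lambda>x. C\<^sup>2 * (cmod (f x))\<^sup>2) has_sum C\<^sup>2 * (ell2_norm f)\<^sup>2) UNIV"
    by (intro has_sum_cmult_right ell2_has_sum assms)
  note * = ell2_dominated[OF has_sum_imp_summable[OF S] le]
  show "diag_op d f \<in> ell2" "(ell2_norm (diag_op d f))\<^sup>2 \<le> C\<^sup>2 * (ell2_norm f)\<^sup>2"
    using * infsumI[OF S] by simp_all
qed

lemma adjoint_pair_diag:
  assumes "\<And>x. \<bar>d x\<bar> \<le> C"
  shows "adjoint_pair (diag_op d) (diag_op d)"
proof -
  have "bounded_op (diag_op d)"
    using diag_op_ell2[OF assms] by (intro bounded_opI) (auto simp: diag_op_def algebra_simps)
  then show ?thesis
    by (auto simp: adjoint_pair_def ell2_inner_def diag_op_def algebra_simps intro!: infsum_cong)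
qed

lemma positive_op_diag:
  assumes "\<And>x. 0 \<le> d x" "\<And>x. d x \<le> C"
  shows "positive_op (diag_op d)"
proof -
  have b: "bounded_op (diag_op d)"
    by (rule adjoint_pairD(1)[OF adjoint_pair_diag[of d C]]) (use assms in auto)
  have "ell2_inner f (diag_op d f) \<in> \<real> \<and> 0 \<le> Re (ell2_inner f (diag_op d f))" if f: "f \<in> ell2" for f
  proof -
    have eq: "cnj (f x) * diag_op d f x = complex_of_real (d x * (cmod (f x))\<^sup>2)" for x
      by (simp add: diag_op_def complex_norm_square algebra_simps del: of_real_power)
    have "0 \<le> (\<Sum>\<^sub>\<infinity>x. complex_of_real (d x * (cmod (f x))\<^sup>2))"
      by (rule infsum_nonneg_complex) (use ell2_inner_summable[OF f bounded_op_in[OF b f]] assms(1)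
        in \<open>auto simp: eq less_eq_complex_def\<close>)
    then show ?thesis
      by (simp add: ell2_inner_def eq complex_is_Real_iff less_eq_complex_def)
  qed
  then show ?thesis using b by (auto simp: positive_op_def)
qed

lemma positive_op_symmetric:
  assumes "positive_op R" "f \<in> ell2" "g \<in> ell2"
  shows "ell2_inner (R f) g = ell2_inner f (R g)"
proof -
  have R: "bounded_op R" using assms(1) by (simp add: positive_op_def)
  note Rin = bounded_op_in[OF R assms(2)] bounded_op_in[OF R assms(3)]
  have real: "Im (ell2_inner h (R h)) = 0" if "h \<in> ell2" for h
    using assms(1) that by (auto simp: positive_op_def complex_is_Real_iff)
  have in1: "(\<lambda>x. c * g x) \<in> ell2" "(\<lambda>x. c * R g x) \<in> ell2" for c
    using assms(3) Rin by (simp_all add: ell2_scale)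
  have Rc: "R (\<lambda>x. f x + c * g x) = (\<lambda>x. R f x + c * R g x)" for c
    using bounded_op_add[OF R assms(2) in1(1)] bounded_op_scale[OF R assms(3)] by simp
  have exp: "ell2_inner (\<lambda>x. f x + c * g x) (R (\<lambda>x. f x + c * g x)) =
     ell2_inner f (R f) + c * ell2_inner f (R g) + cnj c * ell2_inner g (R f)
     + cnj c * c * ell2_inner g (R g)" for c
    unfolding Rc using assms(2,3) Rin in1
    by (simp add: ell2_add ell2_inner_add_left
        ell2_inner_add_right ell2_inner_scale_left ell2_inner_scale_right algebra_simps)
  have c0: "Im (c * ell2_inner f (R g) + cnj c * ell2_inner g (R f) + cnj c * c * ell2_inner g (R g)) = 0" for c
    using real[OF ell2_add(1)[OF assms(2) ell2_scale(1)[OF assms(3), of c]]] real[OF assms(2)]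
    unfolding exp by simp
  have "ell2_inner f (R g) = cnj (ell2_inner g (R f))"
    using c0[of 1] c0[of \<i>] real[OF assms(3)] by (simp add: complex_eq_iff)
  then show ?thesis by (simp add: ell2_inner_cnj[of "R f"])
qed

text \<open>If \<open>R\<^sup>2\<close> is diagonal with entries \<open>d\<close>, then \<open>y = R e - sqrt d e\<close> satisfies
  \<open>R y = - sqrt d y\<close> for each basis vector \<open>e\<close>, so positivity forces \<open>y = 0\<close>.\<close>

lemma positive_sqrt_diag:
  assumes R: "positive_op R" and RR: "op_eq (R \<circ> R) (diag_op d)"
    and d: "\<And>x. 0 \<le> d x" and f: "f \<in> ell2"
  shows "R f = diag_op (\<lambda>x. sqrt (d x)) f"
proof -
  have bR: "bounded_op R" using R by (simp add: positive_op_def)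
  have unit: "R (ell2_unit a) = (\<lambda>x. of_real (sqrt (d a)) * ell2_unit a x)" for a
  proof (cases "d a = 0")
    case True
    have "R (R (ell2_unit a)) = (\<lambda>x. 0)"
      using RR True by (auto simp: op_eq_def diag_op_def fun_eq_iff) (auto simp: ell2_unit_def split: if_splits)
    moreover have "ell2_inner (R (ell2_unit a)) (R (ell2_unit a)) = ell2_inner (ell2_unit a) (R (R (ell2_unit a)))"
      by (rule positive_op_symmetric[OF R]) (simp_all add: bounded_op_in[OF bR])
    ultimately have "ell2_norm (R (ell2_unit a)) = 0"
      by (simp add: ell2_inner_self bounded_op_in[OF bR] ell2_inner_unit)
    then show ?thesis using True ell2_norm_eq_0D[OF bounded_op_in[OF bR ell2_unit_in]] by fastforce
  next
    case False
    define s where "s = sqrt (d a)"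
    have s: "s > 0" using False d[of a] by (simp add: s_def)
    define y where "y = (\<lambda>x. R (ell2_unit a) x - of_real s * ell2_unit a x)"
    have su: "(\<lambda>x. of_real s * ell2_unit a x) \<in> ell2" by (simp add: ell2_scale)
    have y: "y \<in> ell2" unfolding y_def
      by (intro ell2_diff su bounded_op_in[OF bR] ell2_unit_in)
    have "R (R (ell2_unit a)) = (\<lambda>x. of_real s * (of_real s * ell2_unit a x))"
    proof -
      have "R (R (ell2_unit a)) = diag_op d (ell2_unit a)" using RR by (simp add: op_eq_def)
      also have "\<dots> = (\<lambda>x. of_real (s * s) * ell2_unit a x)"
        using d[of a] by (auto simp: diag_op_def ell2_unit_def s_def simp del: of_real_mult)
      finally show ?thesis by (simp add: mult.assoc)
    qed
    then have "R y = (\<lambda>x. of_real (- s) * y x)"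
      unfolding y_def
      by (simp add: bounded_op_diff[OF bR bounded_op_in[OF bR ell2_unit_in] su]
          bounded_op_scale[OF bR ell2_unit_in] algebra_simps)
    then have "ell2_inner y (R y) = of_real (- s * (ell2_norm y)\<^sup>2)"
      using y by (simp add: ell2_inner_scale_right[of y "- of_real s" y, simplified] ell2_inner_self)
    moreover have "0 \<le> Re (ell2_inner y (R y))" using R y by (simp add: positive_op_def)
    ultimately have "s * (ell2_norm y)\<^sup>2 \<le> 0" by simp
    then have "ell2_norm y = 0" using s by (simp add: mult_le_0_iff)
    then have "y x = 0" for x using ell2_norm_eq_0D[OF y] by blast
    then show ?thesis by (auto simp: y_def s_def fun_eq_iff)
  qed
  show ?thesis
  proof
    fix x
    have "R f x = ell2_inner (R (ell2_unit x)) f"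
      using positive_op_symmetric[OF R ell2_unit_in f] by (simp add: ell2_inner_unit)
    also have "\<dots> = diag_op (\<lambda>x. sqrt (d x)) f x"
      by (simp add: unit ell2_inner_scale_left ell2_inner_unit diag_op_def)
    finally show "R f x = diag_op (\<lambda>x. sqrt (d x)) f x" .
  qed
qed

lemma op_sqrt_diag:
  assumes A: "op_eq A (diag_op d)" and d: "\<And>x. 0 \<le> d x" "\<And>x. d x \<le> C" and f: "f \<in> ell2"
  shows "op_sqrt A f = diag_op (\<lambda>x. sqrt (d x)) f"
proof -
  let ?P = "\<lambda>R. positive_op R \<and> op_eq (R \<circ> R) A"
  have "?P (diag_op (\<lambda>x. sqrt (d x)))"
  proof
    show "positive_op (diag_op (\<lambda>x. sqrt (d x)))"
      by (rule positive_op_diag[where C = "sqrt C"]) (use d in auto)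
    have "of_real (sqrt (d x)) * (of_real (sqrt (d x)) * z) = of_real (d x) * z" for x and z :: complex
      using d(1)[of x] by (metis mult.assoc of_real_mult real_sqrt_mult_self abs_of_nonneg)
    then show "op_eq (diag_op (\<lambda>x. sqrt (d x)) \<circ> diag_op (\<lambda>x. sqrt (d x))) A"
      using A by (auto simp: op_eq_def diag_op_def)
  qed
  then have "?P (op_sqrt A)" unfolding op_sqrt_def by (rule someI[of ?P])
  then show ?thesis using A by (intro positive_sqrt_diag d f) (auto simp: op_eq_def)
qed

lemma op_inv_eq:
  assumes "bounded_op B" "op_eq (A \<circ> B) id" "op_eq (B \<circ> A) id" "f \<in> ell2"
  shows "op_inv A f = B f"
proof -
  let ?P = "\<lambda>B. bounded_op B \<and> op_eq (A \<circ> B) id \<and> op_eq (B \<circ> A) id"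
  have P: "?P (op_inv A)" unfolding op_inv_def by (rule someI[of ?P B]) (use assms in auto)
  have "op_inv A (A (B f)) = B f"
    using P bounded_op_in[OF assms(1,4)] by (simp add: op_eq_def)
  moreover have "A (B f) = f" using assms(2,4) by (simp add: op_eq_def)
  ultimately show ?thesis by simp
qed

section \<open>Finite direct sums\<close>

lemma adjoint_pair_zero: "adjoint_pair (\<lambda>f x. 0) (\<lambda>g x. 0)"
  unfolding adjoint_pair_def
  by (auto simp: ell2_inner_def ell2_norm_def intro!: bounded_opI[where C = 0])

lemma adjoint_pair_sum:
  fixes m :: nat
  assumes "\<And>k. k < m \<Longrightarrow> adjoint_pair (T k) (A k)"
  shows "adjoint_pair (\<lambda>f x. \<Sum>k<m. T k f x) (\<lambda>g x. \<Sum>k<m. A k g x)"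
  using assms
proof (induction m)
  case 0
  then show ?case by (simp add: adjoint_pair_zero)
next
  case (Suc m)
  then show ?case using adjoint_pair_add[of "\<lambda>f x. \<Sum>k<m. T k f x" _ "T m" "A m"] by simp
qed

definition block_in :: "nat \<Rightarrow> ('a \<Rightarrow> complex) \<Rightarrow> ('a \<times> nat \<Rightarrow> complex)" where
  "block_in i f = (\<lambda>(x, k). if k = i then f x else 0)"

definition block_out :: "nat \<Rightarrow> ('a \<times> nat \<Rightarrow> complex) \<Rightarrow> ('a \<Rightarrow> complex)" where
  "block_out i g = (\<lambda>x. g (x, i))"

lemma block_in_ell2:
  assumes "f \<in> ell2"
  shows "block_in i f \<in> ell2" "(ell2_norm (block_in i f))\<^sup>2 = (ell2_norm f)\<^sup>2"
proof -
  have "((\<lambda>p. (cmod (block_in i f p))\<^sup>2) has_sum (ell2_norm f)\<^sup>2) (range (\<lambda>x. (x, i)))"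
    using ell2_has_sum[OF assms]
    by (subst has_sum_reindex) (auto simp: inj_on_def o_def block_in_def)
  moreover have "((\<lambda>p. (cmod (block_in i f p))\<^sup>2) has_sum (ell2_norm f)\<^sup>2) (range (\<lambda>x. (x, i)))
      = ((\<lambda>p. (cmod (block_in i f p))\<^sup>2) has_sum (ell2_norm f)\<^sup>2) UNIV"
    by (rule has_sum_cong_neutral) (auto simp: block_in_def)
  ultimately have "((\<lambda>p. (cmod (block_in i f p))\<^sup>2) has_sum (ell2_norm f)\<^sup>2) UNIV" by simp
  then show "block_in i f \<in> ell2" "(ell2_norm (block_in i f))\<^sup>2 = (ell2_norm f)\<^sup>2"
    by (rule has_sum_imp_ell2)+
qed

lemma block_out_ell2:
  assumes "g \<in> ell2"
  shows "block_out i g \<in> ell2" "(ell2_norm (block_out i g))\<^sup>2 \<le> (ell2_norm g)\<^sup>2"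
proof -
  let ?R = "range (\<lambda>x. (x, i))"
  have s: "(\<lambda>p. (cmod (g p))\<^sup>2) summable_on UNIV" using assms by (simp add: ell2_def)
  then have sR: "(\<lambda>p. (cmod (g p))\<^sup>2) summable_on ?R" by (rule summable_on_subset_banach) simp
  have inj: "inj (\<lambda>x. (x, i))" by (simp add: inj_on_def)
  show "block_out i g \<in> ell2"
    using sR unfolding summable_on_reindex[OF inj] by (simp add: ell2_def o_def block_out_def)
  have "(ell2_norm (block_out i g))\<^sup>2 = (\<Sum>\<^sub>\<infinity>p\<in>?R. (cmod (g p))\<^sup>2)"
    unfolding infsum_reindex[OF inj] by (simp add: ell2_norm_sq o_def block_out_def)
  also have "\<dots> \<le> (ell2_norm g)\<^sup>2"
    unfolding ell2_norm_sq by (rule infsum_mono2[OF sR s]) auto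
  finally show "(ell2_norm (block_out i g))\<^sup>2 \<le> (ell2_norm g)\<^sup>2" .
qed

lemma adjoint_pair_block: "adjoint_pair (block_in i) (block_out i)"
proof -
  have "ell2_inner (block_in i f) g = ell2_inner f (block_out i g)" for f :: "'a \<Rightarrow> complex" and g
  proof -
    have inj: "inj (\<lambda>x::'a. (x, i))" by (simp add: inj_on_def)
    have "ell2_inner f (block_out i g) = (\<Sum>\<^sub>\<infinity>p\<in>range (\<lambda>x. (x, i)). cnj (block_in i f p) * g p)"
      unfolding infsum_reindex[OF inj]
      by (simp add: ell2_inner_def o_def block_out_def block_in_def)
    also have "\<dots> = ell2_inner (block_in i f) g"
      unfolding ell2_inner_def by (rule infsum_cong_neutral) (auto simp: block_in_def)
    finally show ?thesis by simp
  qed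
  moreover have "bounded_op (block_in i)"
    by (rule bounded_opI[where C = 1]) (auto simp: block_in_ell2, auto simp: block_in_def)
  moreover have "bounded_op (block_out i)"
    by (rule bounded_opI[where C = 1]) (use block_out_ell2 in simp_all, simp_all add: block_out_def)
  ultimately show ?thesis by (simp add: adjoint_pair_def)
qed

section \<open>A sufficient condition for subnormality\<close>

lemma normal_opI:
  assumes "adjoint_pair N M" "\<And>f. f \<in> ell2 \<Longrightarrow> M (N f) = N (M f)"
  shows "normal_op N"
  using assms by (auto simp: normal_op_def op_eq_def adjoint_pairD bounded_op_in adj_eq)

lemma isometric_embedding:
  assumes "adjoint_pair J K" "\<And>f. f \<in> ell2 \<Longrightarrow> K (J f) = f" "f \<in> ell2"
  shows "ell2_norm (J f) = ell2_norm f"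
proof -
  have "complex_of_real ((ell2_norm (J f))\<^sup>2) = of_real ((ell2_norm f)\<^sup>2)"
    using adjoint_pairD(3)[OF assms(1,3) bounded_op_in[OF adjoint_pairD(1)[OF assms(1)] assms(3)]]
      assms(2,3) bounded_op_in[OF adjoint_pairD(1)[OF assms(1)] assms(3)]
    by (simp add: ell2_inner_self)
  then have "(ell2_norm (J f))\<^sup>2 = (ell2_norm f)\<^sup>2" by (simp only: of_real_eq_iff)
  then show ?thesis by (rule power2_eq_imp_eq) simp_all
qed

definition halmos :: "nat \<Rightarrow> (nat \<Rightarrow> real) \<Rightarrow> (nat \<Rightarrow> ('a \<Rightarrow> complex) \<Rightarrow> 'a \<Rightarrow> complex) \<Rightarrow>
    (nat \<Rightarrow> ('a \<Rightarrow> complex) \<Rightarrow> 'a \<Rightarrow> complex) \<Rightarrow> (nat \<Rightarrow> ('a \<Rightarrow> complex) \<Rightarrow> 'a \<Rightarrow> complex) \<Rightarrow>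
    ('a \<times> nat \<Rightarrow> complex) \<Rightarrow> ('a \<times> nat \<Rightarrow> complex)" where
  "halmos m s V W Q = (\<lambda>g p. \<Sum>k<m. of_real (s k) *
     (block_in (2*k) (V k (block_out (2*k) g)) p +
      (block_in (2*k) (Q k (block_out (2*k+1) g)) p +
       block_in (2*k+1) (W k (block_out (2*k+1) g)) p)))"

definition halmos_adj :: "nat \<Rightarrow> (nat \<Rightarrow> real) \<Rightarrow> (nat \<Rightarrow> ('a \<Rightarrow> complex) \<Rightarrow> 'a \<Rightarrow> complex) \<Rightarrow>
    (nat \<Rightarrow> ('a \<Rightarrow> complex) \<Rightarrow> 'a \<Rightarrow> complex) \<Rightarrow> (nat \<Rightarrow> ('a \<Rightarrow> complex) \<Rightarrow> 'a \<Rightarrow> complex) \<Rightarrow>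
    ('a \<times> nat \<Rightarrow> complex) \<Rightarrow> ('a \<times> nat \<Rightarrow> complex)" where
  "halmos_adj m s V W Q = (\<lambda>g p. \<Sum>k<m. of_real (s k) *
     (block_in (2*k) (W k (block_out (2*k) g)) p +
      (block_in (2*k+1) (Q k (block_out (2*k) g)) p +
       block_in (2*k+1) (V k (block_out (2*k+1) g)) p)))"

lemma adjoint_pair_halmos:
  assumes "\<And>k. k < m \<Longrightarrow> adjoint_pair (V k) (W k)" "\<And>k. k < m \<Longrightarrow> adjoint_pair (Q k) (Q k)"
  shows "adjoint_pair (halmos m s V W Q) (halmos_adj m s V W Q)"
  unfolding halmos_def halmos_adj_def
  by (intro adjoint_pair_sum adjoint_pair_scale adjoint_pair_add
      adjoint_pair_comp[OF adjoint_pair_block adjoint_pair_comp[OF _ adjoint_pair_sym[OF adjoint_pair_block]]]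
      assms adjoint_pair_sym[OF assms(1)])

lemma even_odd_below_cases:
  fixes m :: nat
  obtains k where "i = 2 * k" "k < m" | k where "i = 2 * k + 1" "k < m" | "i \<ge> 2 * m"
proof (cases "i < 2 * m")
  case True
  then have "i = 2 * (i div 2) \<or> i = 2 * (i div 2) + 1" "i div 2 < m" by presburger+
  then show thesis using that(1,2) by blast
qed (use that(3) in auto)

lemma block_eqI:
  fixes f g :: "'a \<times> nat \<Rightarrow> complex"
  assumes "\<And>k. k < m \<Longrightarrow> block_out (2*k) f = block_out (2*k) g"
    and "\<And>k. k < m \<Longrightarrow> block_out (2*k+1) f = block_out (2*k+1) g"
    and "\<And>i x. 2 * m \<le> i \<Longrightarrow> f (x, i) = g (x, i)"
  shows "f = g"
proof
  fix p :: "'a \<times> nat"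
  obtain x i where p: "p = (x, i)" by (cases p)
  show "f p = g p"
    using assms unfolding p block_out_def by (cases i m rule: even_odd_below_cases) metis+
qed

lemma double_neq_Suc_double: "2 * a \<noteq> Suc (2 * b)"
  by presburger

lemma block_halmos:
  shows "k < m \<Longrightarrow> block_out (2*k) (halmos m s V W Q g) =
      (\<lambda>x. of_real (s k) * (V k (block_out (2*k) g) x + Q k (block_out (2*k+1) g) x))"
    and "k < m \<Longrightarrow> block_out (2*k+1) (halmos m s V W Q g) =
      (\<lambda>x. of_real (s k) * W k (block_out (2*k+1) g) x)"
    and "2 * m \<le> i \<Longrightarrow> halmos m s V W Q g (x, i) = 0"
    and "k < m \<Longrightarrow> block_out (2*k) (halmos_adj m s V W Q g) =
      (\<lambda>x. of_real (s k) * W k (block_out (2*k) g) x)"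
    and "k < m \<Longrightarrow> block_out (2*k+1) (halmos_adj m s V W Q g) =
      (\<lambda>x. of_real (s k) * (Q k (block_out (2*k) g) x + V k (block_out (2*k+1) g) x))"
    and "2 * m \<le> i \<Longrightarrow> halmos_adj m s V W Q g (x, i) = 0"
  by (auto simp: halmos_def halmos_adj_def block_in_def block_out_def[of "2*k"] block_out_def[of "Suc (2*k)"]
      double_neq_Suc_double double_neq_Suc_double[symmetric] if_distrib[of "\<lambda>z. c * z" for c]
      distrib_left sum.distrib
      intro!: ext sum.neutral cong: if_cong)

text \<open>On each summand, \<open>N = s U\<close> with \<open>U\<close> the matrix \<open>(V, P - V V*; 0, V*)\<close>; it extends the
  partial isometry \<open>V\<close>, and \<open>U* U = U U*\<close> is the projection \<open>P\<close> on both coordinates.\<close>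

lemma subnormalI:
  fixes T :: "('a \<Rightarrow> complex) \<Rightarrow> 'a \<Rightarrow> complex"
  assumes T: "bounded_op T"
    and VW: "\<And>k. k < (m::nat) \<Longrightarrow> adjoint_pair (V k) (W k)"
    and PP: "\<And>k. k < m \<Longrightarrow> adjoint_pair (P k) (P k)"
    and RR: "\<And>k. k < m \<Longrightarrow> adjoint_pair (R k) (R k)"
    and WV: "\<And>k f. k < m \<Longrightarrow> s k \<noteq> 0 \<Longrightarrow> f \<in> ell2 \<Longrightarrow> W k (V k f) = P k f"
    and VP: "\<And>k f. k < m \<Longrightarrow> f \<in> ell2 \<Longrightarrow> V k (P k f) = V k f"
    and PV: "\<And>k f. k < m \<Longrightarrow> f \<in> ell2 \<Longrightarrow> P k (V k f) = V k f"
    and WP: "\<And>k f. k < m \<Longrightarrow> f \<in> ell2 \<Longrightarrow> W k (P k f) = W k f"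
    and PW: "\<And>k f. k < m \<Longrightarrow> f \<in> ell2 \<Longrightarrow> P k (W k f) = W k f"
    and P2: "\<And>k f. k < m \<Longrightarrow> f \<in> ell2 \<Longrightarrow> P k (P k f) = P k f"
    and R2: "\<And>f. f \<in> ell2 \<Longrightarrow> (\<lambda>x. \<Sum>k<m. R k (R k f) x) = f"
    and VR: "\<And>k f. k < m \<Longrightarrow> f \<in> ell2 \<Longrightarrow> (\<lambda>x. of_real (s k) * V k (R k f) x) = R k (T f)"
  shows "subnormal T"
proof -
  define Q where "Q k = (\<lambda>f x. P k f x + of_real (- 1) * V k (W k f) x)" for k
  have QQ: "adjoint_pair (Q k) (Q k)" if "k < m" for k
    unfolding Q_def by (intro adjoint_pair_add adjoint_pair_scale PP that
        adjoint_pair_comp[OF VW adjoint_pair_sym[OF VW]])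
  note bV = adjoint_pairD(1)[OF VW] and bW = adjoint_pairD(2)[OF VW]
    and bP = adjoint_pairD(1)[OF PP] and bQ = adjoint_pairD(1)[OF QQ] and bR = adjoint_pairD(1)[OF RR]
  note mem = bounded_op_in[OF bV] bounded_op_in[OF bW] bounded_op_in[OF bP] bounded_op_in[OF bQ]
    bounded_op_in[OF bR]
  have Q_eq: "Q k f = (\<lambda>x. P k f x - V k (W k f) x)" for k f by (simp add: Q_def)
  have WQ: "W k (Q k f) = (\<lambda>x. 0)" if "k < m" "s k \<noteq> 0" "f \<in> ell2" for k f
    unfolding Q_eq using that by (simp add: bounded_op_diff[OF bW] mem WP WV PW)
  have QV: "Q k (V k f) = (\<lambda>x. 0)" if "k < m" "s k \<noteq> 0" "f \<in> ell2" for k f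
    unfolding Q_eq using that by (simp add: mem PV WV VP)
  have Q2: "Q k (Q k f) = Q k f" if "k < m" "s k \<noteq> 0" "f \<in> ell2" for k f
  proof -
    have "Q k (Q k f) = (\<lambda>x. Q k (P k f) x - Q k (V k (W k f)) x)"
      using that by (subst (2) Q_eq) (simp add: bounded_op_diff[OF bQ] mem)
    also have "\<dots> = Q k (P k f)" using that by (simp add: QV mem)
    also have "\<dots> = Q k f" unfolding Q_eq using that by (simp add: P2 WP)
    finally show ?thesis .
  qed
  define N where "N = halmos m s V W Q"
  define M where "M = halmos_adj m s V W Q"
  have NM: "adjoint_pair N M" unfolding N_def M_def by (rule adjoint_pair_halmos[OF VW QQ])
  note bo = bounded_op_in[OF adjoint_pairD(2)[OF adjoint_pair_block]]
  note block = block_halmos[where m = m and s = s and V = V and W = W and Q = Q, folded N_def M_def]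
  have "normal_op N"
  proof (rule normal_opI[OF NM])
    fix g :: "'a \<times> nat \<Rightarrow> complex" assume g: "g \<in> ell2"
    note comb = bounded_op_scale[OF bV] bounded_op_scale[OF bW] bounded_op_scale[OF bQ]
      bounded_op_add[OF bV] bounded_op_add[OF bW] bounded_op_add[OF bQ]
    show "M (N g) = N (M g)"
    proof (rule block_eqI[of m])
      fix k assume k: "k < m"
      let ?a = "block_out (2*k) g" and ?b = "block_out (2*k+1) g"
      have ab: "?a \<in> ell2" "?b \<in> ell2" using bo g by blast+
      have in2: "(\<lambda>x. V k ?a x + Q k ?b x) \<in> ell2" "(\<lambda>x. Q k ?a x + V k ?b x) \<in> ell2"
        using ab k by (auto intro!: ell2_add mem)
      show "block_out (2*k) (M (N g)) = block_out (2*k) (N (M g))"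
      proof (cases "s k = 0")
        case True
        then show ?thesis by (simp only: block(1,2,4,5)[OF k]) simp
      next
        case False
        have "block_out (2*k) (M (N g)) = (\<lambda>x. of_real (s k) * (of_real (s k) * P k ?a x))"
          unfolding block(1,2,4,5)[OF k] using False k ab in2 by (simp add: comb mem WV WQ)
        moreover have "block_out (2*k) (N (M g)) = (\<lambda>x. of_real (s k) * (of_real (s k) * P k ?a x))"
          unfolding block(1,2,4,5)[OF k] using False k ab in2 by (simp add: comb mem QV Q2) (simp add: Q_eq algebra_simps)
        ultimately show ?thesis by simp
      qed
      show "block_out (2*k+1) (M (N g)) = block_out (2*k+1) (N (M g))"
      proof (cases "s k = 0")
        case True
        then show ?thesis by (simp only: block(1,2,4,5)[OF k]) simp
      next
        case False
        have "block_out (2*k+1) (M (N g)) = (\<lambda>x. of_real (s k) * (of_real (s k) * P k ?b x))"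
          unfolding block(1,2,4,5)[OF k] using False k ab in2 by (simp add: comb mem QV Q2) (simp add: Q_eq algebra_simps)
        moreover have "block_out (2*k+1) (N (M g)) = (\<lambda>x. of_real (s k) * (of_real (s k) * P k ?b x))"
          unfolding block(1,2,4,5)[OF k] using False k ab in2 by (simp add: comb mem WV WQ)
        ultimately show ?thesis by simp
      qed
    qed (simp add: block)
  qed
  define J where "J = (\<lambda>f p. \<Sum>k<m. block_in (2*k) (R k f) p)"
  define K where "K = (\<lambda>g x. \<Sum>k<m. R k (block_out (2*k) g) x)"
  have JK: "adjoint_pair J K"
    unfolding J_def K_def by (intro adjoint_pair_sum adjoint_pair_comp[OF adjoint_pair_block] RR)
  have Jeven: "block_out (2*k) (J f) = R k f" if "k < m" for k f
    using that by (auto simp: J_def block_in_def block_out_def)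
  have Jodd: "block_out (2*k+1) (J f) = (\<lambda>x. 0)" for k f
    by (auto simp: J_def block_in_def block_out_def double_neq_Suc_double double_neq_Suc_double[symmetric])
  have "K (J f) = f" if "f \<in> ell2" for f
    using R2[OF that] by (simp add: K_def Jeven)
  then have iso: "ell2_norm (J f) = ell2_norm f" if "f \<in> ell2" for f
    using isometric_embedding[OF JK _ that] by blast
  have zero: "V k (\<lambda>x. 0) = (\<lambda>x. 0)" "W k (\<lambda>x. 0) = (\<lambda>x. 0)" "Q k (\<lambda>x. 0) = (\<lambda>x. 0)" if "k < m" for k
    using that bounded_op_scale[OF bV, of k "\<lambda>x. 0" 0] bounded_op_scale[OF bW, of k "\<lambda>x. 0" 0]
      bounded_op_scale[OF bQ, of k "\<lambda>x. 0" 0] by simp_all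
  have "N (J f) = J (T f)" if f: "f \<in> ell2" for f
  proof (rule block_eqI[of m])
    show "block_out (2*k) (N (J f)) = block_out (2*k) (J (T f))" if "k < m" for k
      unfolding block(1,2,4,5)[OF that] Jodd Jeven[OF that] using zero[OF that] VR[OF that f] by simp
    show "block_out (2*k+1) (N (J f)) = block_out (2*k+1) (J (T f))" if "k < m" for k
      unfolding block(1,2,4,5)[OF that] Jodd using zero[OF that] by simp
    show "N (J f) (x, i) = J (T f) (x, i)" if "2 * m \<le> i" for i x
      using that by (auto simp: block J_def block_in_def intro!: sum.neutral)
  qed
  then show ?thesis unfolding subnormal_def
    using T adjoint_pairD(1)[OF JK] iso \<open>normal_op N\<close> by blast
qed

section \<open>Weighted shifts on rooted trees\<close>

locale rooted_tree =
  fixes E :: "('v \<times> 'v) set" and \<omega> :: 'v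
  assumes tree: "directed_tree E" and root: "is_root E \<omega>" and fin: "locally_finite E"
begin

lemma finite_Chi [simp]: "finite (Chi E u)"
  using fin by (simp add: locally_finite_def)

lemma par_unique: "(u, v) \<in> E \<Longrightarrow> (w, v) \<in> E \<Longrightarrow> u = w"
  using tree unfolding directed_tree_def by blast

lemma par_eq [simp]: "(u, v) \<in> E \<Longrightarrow> par E v = u"
  unfolding par_def using par_unique by blast

lemma mem_Chi: "v \<in> Chi E u \<longleftrightarrow> (u, v) \<in> E"
  by (simp add: Chi_def)

lemma reachable: "(\<omega>, v) \<in> E\<^sup>*"
proof -
  have "(\<omega>, v) \<in> (E \<union> E\<inverse>)\<^sup>*" using tree by (simp add: directed_tree_def)
  then show ?thesis
  proof (induction rule: rtrancl_induct)
    case (step u w)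
    show ?case
    proof (cases "(u, w) \<in> E")
      case True
      then show ?thesis using step by auto
    next
      case False
      then have wu: "(w, u) \<in> E" using step by auto
      then have "u \<noteq> \<omega>" using root by (auto simp: is_root_def)
      with step.IH obtain z where "(\<omega>, z) \<in> E\<^sup>*" "(z, u) \<in> E" by (metis rtranclE)
      then show ?thesis using par_unique wu by metis
    qed
  qed simp
qed

lemma tree_induct [case_names root child]:
  assumes "Q \<omega>" "\<And>u v. (u, v) \<in> E \<Longrightarrow> Q u \<Longrightarrow> Q v"
  shows "Q v"
  using reachable[of v] by (induction rule: rtrancl_induct) (use assms in auto)

lemma has_parent_iff: "(\<exists>u. (u, v) \<in> E) \<longleftrightarrow> v \<noteq> \<omega>"
  using root reachable[of v] by (auto simp: is_root_def elim: rtranclE)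

lemma par_edge: "v \<noteq> \<omega> \<Longrightarrow> (par E v, v) \<in> E"
  using has_parent_iff[of v] by auto

lemma child_not_root: "(u, v) \<in> E \<Longrightarrow> v \<noteq> \<omega>"
  using has_parent_iff by blast

lemma bij_betw_edges: "bij_betw snd (Sigma UNIV (Chi E)) (- {\<omega>})"
  unfolding bij_betw_def
proof
  show "inj_on snd (Sigma UNIV (Chi E))"
    by (auto simp: inj_on_def mem_Chi par_unique)
  show "snd ` Sigma UNIV (Chi E) = - {\<omega>}"
    using child_not_root par_edge by (force simp: mem_Chi)
qed

lemma infsum_by_parent:
  fixes h :: "'v \<Rightarrow> 'b :: banach"
  assumes h: "h summable_on - {\<omega>}"
  shows "(\<Sum>\<^sub>\<infinity>v\<in>- {\<omega>}. h v) = (\<Sum>\<^sub>\<infinity>u. \<Sum>v\<in>Chi E u. h v)"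
    and "(\<lambda>u. \<Sum>v\<in>Chi E u. h v) summable_on UNIV"
proof -
  have s: "(\<lambda>(u, v). h v) summable_on Sigma UNIV (Chi E)"
    using h summable_on_reindex_bij_betw[OF bij_betw_edges, of h] by (simp add: case_prod_unfold)
  have "(\<Sum>\<^sub>\<infinity>v\<in>- {\<omega>}. h v) = (\<Sum>\<^sub>\<infinity>(u, v)\<in>Sigma UNIV (Chi E). h v)"
    using infsum_reindex_bij_betw[OF bij_betw_edges, of h] by (simp add: case_prod_unfold)
  then show "(\<Sum>\<^sub>\<infinity>v\<in>- {\<omega>}. h v) = (\<Sum>\<^sub>\<infinity>u. \<Sum>v\<in>Chi E u. h v)"
    using infsum_Sigma'_banach[OF s] by simp
  show "(\<lambda>u. \<Sum>v\<in>Chi E u. h v) summable_on UNIV"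
    using summable_on_Sigma_banach[OF s] by simp
qed

lemma summable_by_parent:
  fixes h :: "'v \<Rightarrow> real"
  assumes "(\<lambda>u. \<Sum>v\<in>Chi E u. h v) summable_on UNIV" "\<And>v. h v \<ge> 0"
  shows "h summable_on - {\<omega>}"
proof -
  have "(\<lambda>p. h (snd p)) summable_on Sigma UNIV (Chi E)"
    by (rule summable_on_SigmaI[OF has_sum_finite]) (use assms in auto)
  then show ?thesis using summable_on_reindex_bij_betw[OF bij_betw_edges, of h] by simp
qed

definition wshift :: "('v \<Rightarrow> real) \<Rightarrow> ('v \<Rightarrow> complex) \<Rightarrow> 'v \<Rightarrow> complex" where
  "wshift w f = (\<lambda>v. if v = \<omega> then 0 else of_real (w v) * f (par E v))"

definition coshift :: "('v \<Rightarrow> real) \<Rightarrow> ('v \<Rightarrow> complex) \<Rightarrow> 'v \<Rightarrow> complex" where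
  "coshift w g = (\<lambda>u. \<Sum>v\<in>Chi E u. of_real (w v) * g v)"

lemma coshift_wshift: "coshift w (wshift w f) = diag_op (\<lambda>u. \<Sum>v\<in>Chi E u. (w v)\<^sup>2) f"
  by (auto simp: coshift_def wshift_def diag_op_def child_not_root mem_Chi sum_distrib_right
      power2_eq_square mult.assoc intro!: ext sum.cong)

context
  fixes w :: "'v \<Rightarrow> real" and B :: real
  assumes w: "\<And>u. (\<Sum>v\<in>Chi E u. (w v)\<^sup>2) \<le> B"
begin

lemma wshift_ell2:
  assumes f: "f \<in> ell2"
  shows "wshift w f \<in> ell2" "(ell2_norm (wshift w f))\<^sup>2 \<le> B * (ell2_norm f)\<^sup>2"
proof -
  let ?h = "\<lambda>v. (cmod (wshift w f v))\<^sup>2"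
  have eq: "(\<Sum>v\<in>Chi E u. ?h v) = (\<Sum>v\<in>Chi E u. (w v)\<^sup>2) * (cmod (f u))\<^sup>2" for u
    unfolding sum_distrib_right
    by (rule sum.cong) (auto simp: wshift_def mem_Chi child_not_root norm_mult power_mult_distrib)
  have le: "(\<Sum>v\<in>Chi E u. ?h v) \<le> B * (cmod (f u))\<^sup>2" for u
    unfolding eq by (rule mult_right_mono[OF w]) simp
  have B: "((\<lambda>u. B * (cmod (f u))\<^sup>2) has_sum B * (ell2_norm f)\<^sup>2) UNIV"
    by (intro has_sum_cmult_right ell2_has_sum f)
  have sC: "(\<lambda>u. \<Sum>v\<in>Chi E u. ?h v) summable_on UNIV"
    by (rule summable_on_comparison_test[OF has_sum_imp_summable[OF B] le]) (simp add: sum_nonneg)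
  have s: "?h summable_on - {\<omega>}" by (rule summable_by_parent[OF sC]) simp
  have cong: "?h summable_on UNIV \<longleftrightarrow> ?h summable_on - {\<omega>}"
    by (rule summable_on_cong_neutral) (auto simp: wshift_def)
  then show "wshift w f \<in> ell2" using s by (simp add: ell2_def)
  have "(ell2_norm (wshift w f))\<^sup>2 = infsum ?h (- {\<omega>})"
    unfolding ell2_norm_sq by (rule infsum_cong_neutral) (auto simp: wshift_def)
  also have "\<dots> = (\<Sum>\<^sub>\<infinity>u. \<Sum>v\<in>Chi E u. ?h v)" by (rule infsum_by_parent[OF s])
  also have "\<dots> \<le> (\<Sum>\<^sub>\<infinity>u. B * (cmod (f u))\<^sup>2)"
    by (rule infsum_mono[OF sC has_sum_imp_summable[OF B] le])
  also have "\<dots> = B * (ell2_norm f)\<^sup>2" by (rule infsumI[OF B])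
  finally show "(ell2_norm (wshift w f))\<^sup>2 \<le> B * (ell2_norm f)\<^sup>2" .
qed

lemma coshift_ell2:
  assumes g: "g \<in> ell2"
  shows "coshift w g \<in> ell2" "(ell2_norm (coshift w g))\<^sup>2 \<le> B * (ell2_norm g)\<^sup>2"
proof -
  have B0: "B \<ge> 0" using w[of \<omega>] by (meson order_trans sum_nonneg zero_le_power2)
  let ?h = "\<lambda>v. (cmod (g v))\<^sup>2"
  have sU: "?h summable_on UNIV" using g by (simp add: ell2_def)
  then have s: "?h summable_on - {\<omega>}" by (rule summable_on_subset_banach) simp
  note by_parent = infsum_by_parent[OF s]
  have le: "(cmod (coshift w g u))\<^sup>2 \<le> B * (\<Sum>v\<in>Chi E u. ?h v)" for u
  proof -
    have "cmod (coshift w g u) \<le> (\<Sum>v\<in>Chi E u. \<bar>w v\<bar> * cmod (g v))"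
      unfolding coshift_def by (rule order_trans[OF norm_sum]) (simp add: norm_mult)
    then have "(cmod (coshift w g u))\<^sup>2 \<le> (\<Sum>v\<in>Chi E u. \<bar>w v\<bar> * cmod (g v))\<^sup>2"
      by (rule power_mono) simp
    also have "\<dots> \<le> (\<Sum>v\<in>Chi E u. \<bar>w v\<bar>\<^sup>2) * (\<Sum>v\<in>Chi E u. ?h v)"
      by (rule Cauchy_Schwarz_ineq_sum)
    also have "\<dots> \<le> B * (\<Sum>v\<in>Chi E u. ?h v)"
      using w[of u] by (intro mult_right_mono) (simp_all add: sum_nonneg)
    finally show ?thesis .
  qed
  have sB: "(\<lambda>u. B * (\<Sum>v\<in>Chi E u. ?h v)) summable_on UNIV"
    by (rule summable_on_cmult_right[OF by_parent(2)])
  note dom = ell2_dominated[of _ "coshift w g", OF sB le]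
  show "coshift w g \<in> ell2" by (rule dom)
  have "(ell2_norm (coshift w g))\<^sup>2 \<le> B * (\<Sum>\<^sub>\<infinity>u. \<Sum>v\<in>Chi E u. ?h v)"
    using dom(2) by (simp add: infsum_cmult_right')
  also have "\<dots> = B * infsum ?h (- {\<omega>})" using by_parent(1) by simp
  also have "\<dots> \<le> B * (ell2_norm g)\<^sup>2" unfolding ell2_norm_sq
    by (intro mult_left_mono infsum_mono2 s sU B0) auto
  finally show "(ell2_norm (coshift w g))\<^sup>2 \<le> B * (ell2_norm g)\<^sup>2" .
qed

lemma adjoint_pair_wshift: "adjoint_pair (wshift w) (coshift w)"
  unfolding adjoint_pair_def
proof (intro conjI ballI)
  show "bounded_op (wshift w)"
    by (rule bounded_opI[where C = B]) (use wshift_ell2 in simp_all, simp_all add: wshift_def algebra_simps)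
  show "bounded_op (coshift w)"
    by (rule bounded_opI[where C = B])
      (use coshift_ell2 in simp_all, simp_all add: coshift_def algebra_simps sum.distrib sum_distrib_left)
  fix f g :: "'v \<Rightarrow> complex" assume f: "f \<in> ell2" and g: "g \<in> ell2"
  let ?h = "\<lambda>v. cnj (wshift w f v) * g v"
  have s: "?h summable_on - {\<omega>}"
    by (rule summable_on_subset_banach[OF ell2_inner_summable[OF wshift_ell2(1)[OF f] g]]) simp
  have "ell2_inner (wshift w f) g = infsum ?h (- {\<omega>})"
    unfolding ell2_inner_def by (rule infsum_cong_neutral) (auto simp: wshift_def)
  also have "\<dots> = (\<Sum>\<^sub>\<infinity>u. \<Sum>v\<in>Chi E u. ?h v)" by (rule infsum_by_parent[OF s])
  also have "\<dots> = ell2_inner f (coshift w g)"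
    unfolding ell2_inner_def coshift_def sum_distrib_left
    by (intro infsum_cong sum.cong) (auto simp: wshift_def mem_Chi child_not_root)
  finally show "ell2_inner (wshift w f) g = ell2_inner f (coshift w g)" .
qed

end

end

section \<open>Subnormality of weighted shifts and degree bounds\<close>

context rooted_tree
begin

text \<open>The assumption \<open>moment\<close> says that \<open>T* p\<^sub>k T = t\<^sub>k p\<^sub>k\<close> for the multiplication operators \<open>p\<^sub>k\<close>;
  hence \<open>T*\<^sup>n T\<^sup>n\<close> is the sum of the \<open>t\<^sub>k\<^sup>n p\<^sub>k\<close>.\<close>

lemma subnormal_wshift_moments:
  fixes p :: "nat \<Rightarrow> 'v \<Rightarrow> real" and t :: "nat \<Rightarrow> real" and c :: "'v \<Rightarrow> real"
  assumes T: "bounded_op T" "op_eq T (wshift (\<lambda>v. c (par E v)))"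
    and p: "\<And>k v. k < m \<Longrightarrow> p k v \<ge> 0" and p1: "\<And>v. (\<Sum>k<m. p k v) = 1"
    and t: "\<And>k. k < m \<Longrightarrow> t k \<ge> 0" and c: "\<And>u. c u \<noteq> 0"
    and moment: "\<And>k u. k < m \<Longrightarrow> (c u)\<^sup>2 * (\<Sum>v\<in>Chi E u. p k v) = t k * p k u"
  shows "subnormal T"
proof -
  define w where "w k v = c (par E v) * sqrt (p k v) / (sqrt (t k) * sqrt (p k (par E v)))" for k v
  define M where "M k v = (if p k v = 0 then 0 else 1 :: real)" for k v
  have w2: "(\<Sum>v\<in>Chi E u. (w k v)\<^sup>2) = (if t k = 0 then 0 else M k u)" if k: "k < m" for k u
  proof -
    have "(w k v)\<^sup>2 = (c u)\<^sup>2 * p k v / (t k * p k u)" if "v \<in> Chi E u" for v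
      using that p[OF k] t[OF k] by (simp add: w_def mem_Chi power_mult_distrib power_divide)
    then have "(\<Sum>v\<in>Chi E u. (w k v)\<^sup>2) = (t k * p k u) / (t k * p k u)"
      by (simp add: moment[OF k, symmetric] sum_distrib_left flip: sum_divide_distrib)
    then show ?thesis by (simp add: M_def)
  qed
  have p_child: "p k v = 0" if "k < m" "(u, v) \<in> E" "t k = 0 \<or> p k u = 0" for k u v
  proof -
    have "(\<Sum>v\<in>Chi E u. p k v) = 0" using moment[OF that(1), of u] that(3) c[of u] by auto
    then show ?thesis using that p by (subst (asm) sum_nonneg_eq_0_iff) (auto simp: mem_Chi)
  qed
  have p_le: "p k v \<le> 1" if "k < m" for k v
    using member_le_sum[of k "{..<m}" "\<lambda>k. p k v"] p p1[of v] that by auto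
  have wM': "of_real (w k v) * (of_real (M k (par E v)) * z) = of_real (w k v) * z"
    "of_real (w k v) * (of_real (M k v) * z) = of_real (w k v) * z" for k v and z :: complex
    by (simp_all add: M_def w_def)
  have Mz: "of_real (M k v) * (of_real (M k v) * z) = of_real (M k v) * z" for k v and z :: complex
    by (simp add: M_def)
  show ?thesis
  proof (rule subnormalI[OF T(1), where m = m and s = "\<lambda>k. sqrt (t k)" and V = "\<lambda>k. wshift (w k)"
        and W = "\<lambda>k. coshift (w k)" and P = "\<lambda>k. diag_op (M k)" and R = "\<lambda>k. diag_op (\<lambda>v. sqrt (p k v))"])
    fix k assume k: "k < m"
    show "adjoint_pair (wshift (w k)) (coshift (w k))"
      by (rule adjoint_pair_wshift[where B = 1]) (use w2[OF k] in \<open>auto simp: M_def\<close>)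
    show "adjoint_pair (diag_op (M k)) (diag_op (M k))"
      by (rule adjoint_pair_diag[where C = 1]) (auto simp: M_def)
    show "adjoint_pair (diag_op (\<lambda>v. sqrt (p k v))) (diag_op (\<lambda>v. sqrt (p k v)))"
      by (rule adjoint_pair_diag[where C = 1]) (use p[OF k] p_le[OF k] in auto)
    fix f :: "'v \<Rightarrow> complex" assume f: "f \<in> ell2"
    show "coshift (w k) (wshift (w k) f) = diag_op (M k) f" if "sqrt (t k) \<noteq> 0"
      using that by (simp add: coshift_wshift w2[OF k])
    show "wshift (w k) (diag_op (M k) f) = wshift (w k) f"
      by (simp add: wshift_def diag_op_def wM' cong: if_cong)
    show "diag_op (M k) (wshift (w k) f) = wshift (w k) f"
      by (auto simp: wshift_def diag_op_def w_def M_def fun_eq_iff)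
    show "coshift (w k) (diag_op (M k) f) = coshift (w k) f"
      by (auto simp: coshift_def diag_op_def wM')
    show "diag_op (M k) (coshift (w k) f) = coshift (w k) f"
    proof
      fix u
      have "of_real (M k u) * (of_real (w k v) * f v) = of_real (w k v) * f v" if "v \<in> Chi E u" for v
        using that wM'(1)[of k v "f v"] by (simp add: mem_Chi mult.left_commute)
      then show "diag_op (M k) (coshift (w k) f) u = coshift (w k) f u"
        unfolding coshift_def diag_op_def sum_distrib_left by (rule sum.cong[OF refl])
    qed
    show "diag_op (M k) (diag_op (M k) f) = diag_op (M k) f"
      by (simp add: diag_op_def Mz)
    have "sqrt (t k) * (w k v * sqrt (p k u)) = sqrt (p k v) * c u" if "(u, v) \<in> E" for u v
      using p_child[OF k that] that by (auto simp: w_def)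
    then have eq: "of_real (sqrt (t k)) * (of_real (w k v) * (of_real (sqrt (p k u)) * z))
        = of_real (sqrt (p k v)) * (of_real (c u) * z)" if "(u, v) \<in> E" for u v and z :: complex
      using that by (simp flip: mult.assoc of_real_mult)
    have "T f = wshift (\<lambda>v. c (par E v)) f" using T(2) f by (simp add: op_eq_def)
    then show "(\<lambda>x. of_real (sqrt (t k)) * wshift (w k) (diag_op (\<lambda>v. sqrt (p k v)) f) x) =
        diag_op (\<lambda>v. sqrt (p k v)) (T f)"
      by (auto simp: wshift_def diag_op_def eq[OF par_edge] fun_eq_iff)
  next
    fix f :: "'v \<Rightarrow> complex"
    have "(\<Sum>k<m. of_real (sqrt (p k x)) * (of_real (sqrt (p k x)) * f x)) = f x" for x
    proof -
      have "(\<Sum>k<m. of_real (sqrt (p k x)) * (of_real (sqrt (p k x)) * f x)) = of_real (\<Sum>k<m. p k x) * f x"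
        unfolding of_real_sum sum_distrib_right
        by (rule sum.cong) (use p in \<open>auto simp flip: mult.assoc of_real_mult\<close>)
      then show ?thesis by (simp add: p1)
    qed
    then show "(\<lambda>x. \<Sum>k<m. diag_op (\<lambda>v. sqrt (p k v)) (diag_op (\<lambda>v. sqrt (p k v)) f) x) = f"
      by (simp add: diag_op_def)
  qed
qed

lemma adjacency_op_eq_wshift: "adjacency_op E = wshift (\<lambda>v. 1)"
  by (auto simp: adjacency_op_def wshift_def has_parent_iff fun_eq_iff)

lemma deg_le_of_bounded:
  assumes "bounded_op (adjacency_op E)"
  obtains C where "\<And>u. real (deg E u) \<le> C"
proof -
  obtain C where C: "\<And>f. f \<in> ell2 \<Longrightarrow> (ell2_norm (adjacency_op E f))\<^sup>2 \<le> C * (ell2_norm f)\<^sup>2"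
    using bounded_op_bound[OF assms] by blast
  have "(ell2_norm (adjacency_op E (ell2_unit u)))\<^sup>2 = real (deg E u)" for u
  proof -
    have "(ell2_norm (adjacency_op E (ell2_unit u)))\<^sup>2 = (\<Sum>\<^sub>\<infinity>v\<in>Chi E u. 1)"
      unfolding ell2_norm_sq adjacency_op_eq_wshift
      by (rule infsum_cong_neutral)
        (auto simp: wshift_def ell2_unit_def mem_Chi child_not_root dest: par_edge)
    then show ?thesis by (simp add: deg_def)
  qed
  then have "real (deg E u) \<le> C" for u
    using C[OF ell2_unit_in[of u]] by (simp add: ell2_norm_unit)
  then show thesis by (rule that)
qed

end

section \<open>Trees with a 2-isometric adjacency operator\<close>

locale two_isometric_tree = rooted_tree E \<omega> for E :: "('v \<times> 'v) set" and \<omega> +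
  assumes leafless: "leafless E"
    and two_isometry: "two_isometry (adjacency_op E)"
begin

definition excess :: "'v \<Rightarrow> real" where
  "excess u = real (deg E u) - 1"

lemma deg_pos: "deg E u \<ge> 1"
  using leafless by (simp add: leafless_def deg_def Suc_le_eq card_gt_0_iff)

lemma excess_nonneg: "excess u \<ge> 0"
  using deg_pos[of u] by (simp add: excess_def)

lemma bounded_adjacency: "bounded_op (adjacency_op E)"
  using two_isometry by (simp add: two_isometry_def)

lemma deg_bounded: obtains C where "\<And>u. real (deg E u) \<le> C"
  using deg_le_of_bounded[OF bounded_adjacency] by blast

lemma adjoint_pair_adjacency: "adjoint_pair (adjacency_op E) (coshift (\<lambda>v. 1))"
proof -
  obtain C where "\<And>u. real (deg E u) \<le> C" using deg_bounded by blast
  then show ?thesis unfolding adjacency_op_eq_wshift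
    by (intro adjoint_pair_wshift[where B = C]) (simp add: deg_def)
qed

lemma adj_adjacency: "g \<in> ell2 \<Longrightarrow> adj (adjacency_op E) g = coshift (\<lambda>v. 1) g"
  by (rule adj_eq[OF adjoint_pair_adjacency])

lemma adjacency_in: "f \<in> ell2 \<Longrightarrow> adjacency_op E f \<in> ell2"
  by (rule bounded_op_in[OF bounded_adjacency])

lemma adjacency_star_adjacency:
  "f \<in> ell2 \<Longrightarrow> adj (adjacency_op E) (adjacency_op E f) = diag_op (\<lambda>u. real (deg E u)) f"
  by (simp add: adj_adjacency adjacency_in) (simp add: adjacency_op_eq_wshift coshift_wshift deg_def)

lemma diag_deg_in:
  assumes "f \<in> ell2" shows "diag_op (\<lambda>u. real (deg E u)) f \<in> ell2"
proof -
  obtain C where "\<And>u. real (deg E u) \<le> C" using deg_bounded by blast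
  then show ?thesis by (intro diag_op_ell2(1)[of _ C] assms) simp
qed

lemma sum_deg_Chi: "(\<Sum>v\<in>Chi E u. real (deg E v)) = 2 * real (deg E u) - 1"
proof -
  let ?T = "adjacency_op E"
  let ?f = "ell2_unit u"
  have f: "?f \<in> ell2" and Tf: "?T ?f \<in> ell2" by (simp_all add: adjacency_in)
  have "?f u - 2 * adj ?T (?T ?f) u + adj ?T (adj ?T (?T (?T ?f))) u = 0"
    using two_isometry f unfolding two_isometry_def op_eq_def by meson
  moreover have "adj ?T (adj ?T (?T (?T ?f))) u = (\<Sum>v\<in>Chi E u. of_nat (deg E v))"
    unfolding adjacency_star_adjacency[OF Tf] adj_adjacency[OF diag_deg_in[OF Tf]]
    by (auto simp: coshift_def diag_op_def adjacency_op_eq_wshift wshift_def mem_Chi child_not_root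
        ell2_unit_def intro!: sum.cong)
  moreover have "adj ?T (?T ?f) u = of_nat (deg E u)"
    unfolding adjacency_star_adjacency[OF f] by (simp add: diag_op_def ell2_unit_def)
  moreover have "?f u = 1" by (simp add: ell2_unit_def)
  ultimately have "1 - 2 * of_nat (deg E u) + (\<Sum>v\<in>Chi E u. complex_of_nat (deg E v)) = 0"
    by simp
  then have "complex_of_real (\<Sum>v\<in>Chi E u. real (deg E v)) = of_real (2 * real (deg E u) - 1)"
    by (simp add: algebra_simps)
  then show ?thesis by (simp only: of_real_eq_iff)
qed

lemma sum_excess_Chi: "(\<Sum>v\<in>Chi E u. excess v) = excess u"
  using sum_deg_Chi[of u] by (simp add: excess_def sum_subtractf deg_def)

lemma excess_child_le: "(u, v) \<in> E \<Longrightarrow> excess v \<le> excess u"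
  using member_le_sum[of v "Chi E u" excess] by (simp add: sum_excess_Chi mem_Chi excess_nonneg)

lemma deg_child_le: "(u, v) \<in> E \<Longrightarrow> deg E v \<le> deg E u"
  using excess_child_le[of u v] by (simp add: excess_def)

lemma deg_eq_1_of_root: "deg E \<omega> = 1 \<Longrightarrow> deg E u = 1"
proof (induction u rule: tree_induct)
  case (child u v)
  then show ?case using deg_child_le[of u v] deg_pos[of v] by simp
qed

lemma cauchy_dual_adjacency:
  "op_eq (cauchy_dual (adjacency_op E)) (wshift (\<lambda>v. 1 / real (deg E (par E v))))"
proof -
  let ?T = "adjacency_op E"
  let ?B = "diag_op (\<lambda>u. 1 / real (deg E u))"
  have le: "\<bar>1 / real (deg E u)\<bar> \<le> 1" for u using deg_pos[of u] by simp
  have B: "bounded_op ?B" by (rule adjoint_pairD(1)[OF adjoint_pair_diag[OF le]])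
  have nz: "deg E u \<noteq> 0" for u using deg_pos[of u] by simp
  have "op_inv (adj ?T \<circ> ?T) f = ?B f" if "f \<in> ell2" for f
  proof (rule op_inv_eq[OF B _ _ that])
    show "op_eq (adj ?T \<circ> ?T \<circ> ?B) id"
      using adjacency_star_adjacency[OF bounded_op_in[OF B]]
      by (auto simp: op_eq_def) (auto simp: diag_op_def nz)
    show "op_eq (?B \<circ> (adj ?T \<circ> ?T)) id"
      by (auto simp: op_eq_def adjacency_star_adjacency) (auto simp: diag_op_def nz)
  qed
  then show ?thesis
    by (auto simp: op_eq_def cauchy_dual_def) (auto simp: adjacency_op_eq_wshift wshift_def diag_op_def)
qed

lemma cauchy_dual_weight: "(\<Sum>v\<in>Chi E u. (1 / real (deg E (par E v)))\<^sup>2) \<le> 1"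
proof -
  have "(\<Sum>v\<in>Chi E u. (1 / real (deg E (par E v)))\<^sup>2) = (\<Sum>v\<in>Chi E u. (1 / real (deg E u))\<^sup>2)"
    by (rule sum.cong) (auto simp: mem_Chi)
  also have "\<dots> = 1 / real (deg E u)"
    using deg_pos[of u] by (simp add: deg_def[symmetric] power2_eq_square)
  also have "\<dots> \<le> 1" using deg_pos[of u] by simp
  finally show ?thesis .
qed

lemma bounded_cauchy_dual: "bounded_op (cauchy_dual (adjacency_op E))"
proof (rule bounded_op_cong)
  show "bounded_op (wshift (\<lambda>v. 1 / real (deg E (par E v))))"
    by (rule adjoint_pairD(1)[OF adjoint_pair_wshift[OF cauchy_dual_weight]])
  show "op_eq (wshift (\<lambda>v. 1 / real (deg E (par E v)))) (cauchy_dual (adjacency_op E))"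
    using cauchy_dual_adjacency by (simp add: op_eq_def)
qed

lemma contraction_cauchy_dual: "contraction (cauchy_dual (adjacency_op E))"
  unfolding contraction_def
proof (intro conjI ballI bounded_cauchy_dual)
  fix f :: "'v \<Rightarrow> complex" assume f: "f \<in> ell2"
  have "cauchy_dual (adjacency_op E) f = wshift (\<lambda>v. 1 / real (deg E (par E v))) f"
    using cauchy_dual_adjacency f by (simp add: op_eq_def)
  then have "(ell2_norm (cauchy_dual (adjacency_op E) f))\<^sup>2 \<le> (ell2_norm f)\<^sup>2"
    using wshift_ell2(2)[OF cauchy_dual_weight f] by simp
  then show "ell2_norm (cauchy_dual (adjacency_op E) f) \<le> ell2_norm f"
    by (rule power2_le_imp_le) simp
qed

lemma subnormal_cauchy_dualI:
  fixes p :: "nat \<Rightarrow> 'v \<Rightarrow> real" and t :: "nat \<Rightarrow> real"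
  assumes "\<And>k v. k < m \<Longrightarrow> p k v \<ge> 0" "\<And>v. (\<Sum>k<m. p k v) = 1" "\<And>k. k < m \<Longrightarrow> t k \<ge> 0"
    and "\<And>k u. k < m \<Longrightarrow> (\<Sum>v\<in>Chi E u. p k v) = (real (deg E u))\<^sup>2 * (t k * p k u)"
  shows "subnormal (cauchy_dual (adjacency_op E))"
proof (rule subnormal_wshift_moments[OF bounded_cauchy_dual, where m = m and p = p and t = t and c = "\<lambda>u. 1 / real (deg E u)"])
  have nz: "deg E u \<noteq> 0" for u using deg_pos[of u] by simp
  then show "1 / real (deg E u) \<noteq> 0" for u by simp
  show "(1 / real (deg E u))\<^sup>2 * (\<Sum>v\<in>Chi E u. p k v) = t k * p k u" if "k < m" for k u
    using assms(4)[OF that] nz[of u] by (simp add: power_divide)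
qed (use assms cauchy_dual_adjacency in auto)

lemma sum_affine_excess_Chi:
  "(\<Sum>v\<in>Chi E u. a + b * excess v) = a * real (deg E u) + b * excess u"
  by (simp add: sum.distrib sum_excess_Chi deg_def flip: sum_distrib_left)

text \<open>On a vertex of degree \<open>l\<close> the moments satisfy \<open>a (n+1) = (a n + l - 1) / l\<^sup>2\<close>, \<open>a 0 = 1\<close>,
  i.e. \<open>a n = 1/(l+1) + (l/(l+1)) / l ^ (2 n)\<close>; on the other vertices \<open>a n = 1\<close>.\<close>

lemma subnormal_cauchy_dual_one_or_root_degree:
  assumes "\<And>u. u \<noteq> \<omega> \<Longrightarrow> deg E u = 1 \<or> deg E u = deg E \<omega>"
  shows "subnormal (cauchy_dual (adjacency_op E))"
proof -
  define l where "l = real (deg E \<omega>)"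
  have l: "l \<ge> 1" using deg_pos[of \<omega>] by (simp add: l_def)
  define c where "c = l / ((l - 1) * (l + 1))"
  have deg: "real (deg E u) = 1 \<or> real (deg E u) = l" for u using assms[of u] by (auto simp: l_def)
  have c: "c \<ge> 0" using l by (simp add: c_def)
  have cl: "c * (l - 1) = l / (l + 1)" if "l \<noteq> 1" using that l by (simp add: c_def)
  have ce: "c * excess u \<le> 1" for u
    using deg[of u] cl l by (cases "l = 1") (auto simp: excess_def)
  define p where "p k u = (if k = (0::nat) then 1 - c * excess u else c * excess u)" for k u
  define t where "t k = (if k = (0::nat) then 1 else 1 / l\<^sup>2)" for k
  show ?thesis
  proof (rule subnormal_cauchy_dualI[where m = 2 and p = p and t = t])
    fix k :: nat and u
    show "p k u \<ge> 0" using ce[of u] c excess_nonneg[of u] by (simp add: p_def)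
    show "t k \<ge> 0" by (simp add: t_def)
    show "(\<Sum>k<2. p k u) = 1" by (simp add: p_def numeral_2_eq_2)
    show "(\<Sum>v\<in>Chi E u. p k v) = (real (deg E u))\<^sup>2 * (t k * p k u)"
    proof (cases "real (deg E u) = 1")
      case True
      then show ?thesis
        using sum_affine_excess_Chi[of 1 "- c" u] sum_affine_excess_Chi[of 0 c u]
        by (simp add: p_def t_def excess_def)
    next
      case False
      then have u: "real (deg E u) = l" "l \<noteq> 1" using deg[of u] by auto
      have "l + (- (c * (l - 1))) = l\<^sup>2 * (1 - c * (l - 1))"
        unfolding cl[OF u(2)] using l by (simp add: divide_simps) (simp add: power2_eq_square algebra_simps)
      then show ?thesis
        using sum_affine_excess_Chi[of 1 "- c" u] sum_affine_excess_Chi[of 0 c u] l u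
        by (simp add: p_def t_def excess_def)
    qed
  qed
qed

lemma root_children_degrees:
  assumes l: "deg E \<omega> \<ge> 2" and card: "card {v \<in> Chi E \<omega>. deg E v = 2} = deg E \<omega> - 1"
    and v: "v \<in> Chi E \<omega>"
  shows "deg E v = 1 \<or> deg E v = 2"
proof (rule ccontr)
  assume *: "\<not> (deg E v = 1 \<or> deg E v = 2)"
  let ?A = "{v \<in> Chi E \<omega>. deg E v = 2}"
  have "(\<Sum>v\<in>insert v ?A. excess v) \<le> excess \<omega>"
    unfolding sum_excess_Chi[symmetric, of \<omega>] by (rule sum_mono2) (use v excess_nonneg in auto)
  moreover have "(\<Sum>v\<in>?A. excess v) = excess \<omega>"
    using card l by (simp add: excess_def of_nat_diff)
  ultimately have "excess v \<le> 0" using * by (subst (asm) sum.insert) auto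
  then show False using * deg_pos[of v] by (simp add: excess_def)
qed

lemma nonroot_degrees:
  assumes l: "deg E \<omega> \<ge> 2" and card: "card {v \<in> Chi E \<omega>. deg E v = 2} = deg E \<omega> - 1"
    and v: "v \<noteq> \<omega>"
  shows "deg E v = 1 \<or> deg E v = 2"
proof -
  have "v \<noteq> \<omega> \<longrightarrow> deg E v = 1 \<or> deg E v = 2"
  proof (induction v rule: tree_induct)
    case (child u v)
    show ?case
    proof (cases "u = \<omega>")
      case True
      then show ?thesis using root_children_degrees[OF l card] child by (auto simp: mem_Chi)
    next
      case False
      then show ?thesis using child deg_child_le[of u v] deg_pos[of v] by auto
    qed
  qed simp
  with v show ?thesis by simp
qed

text \<open>Below the root the moments are those of the previous case with \<open>l = 2\<close>; the root moments
  follow from \<open>a (n+1) = (1 + (l-1) b n) / l\<^sup>2\<close>, where \<open>b\<close> belongs to degree 2, and have an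
  extra atom at 0.\<close>

lemma subnormal_cauchy_dual_children_degree_2:
  assumes "deg E \<omega> \<ge> 2" "card {v \<in> Chi E \<omega>. deg E v = 2} = deg E \<omega> - 1"
  shows "subnormal (cauchy_dual (adjacency_op E))"
proof -
  define l where "l = real (deg E \<omega>)"
  have l: "l \<ge> 2" using assms(1) by (simp add: l_def)
  have deg: "excess u = 0 \<or> excess u = 1" if "u \<noteq> \<omega>" for u
    using nonroot_degrees[OF assms that] by (auto simp: excess_def)
  define r :: "nat \<Rightarrow> real" where "r k = (if k = 0 then (l + 2) / (3 * l\<^sup>2)
      else if k = 1 then 8 * (l - 1) / (3 * l\<^sup>2) else (l - 1) * (l - 2) / l\<^sup>2)" for k
  define b :: "nat \<Rightarrow> real" where "b k = (if k = 0 then - 2 / 3 else if k = 1 then 2 / 3 else 0)" for k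
  define a :: "nat \<Rightarrow> real" where "a k = (if k = 0 then 1 else 0)" for k
  define p where "p k u = (if u = \<omega> then r k else a k + b k * excess u)" for k u
  define t :: "nat \<Rightarrow> real" where "t k = (if k = 0 then 1 else if k = 1 then 1 / 4 else 0)" for k
  show ?thesis
  proof (rule subnormal_cauchy_dualI[where m = 3 and p = p and t = t])
    fix k :: nat and u assume "k < 3"
    then have k: "k = 0 \<or> k = 1 \<or> k = 2" by auto
    show "t k \<ge> 0" by (simp add: t_def)
    show "p k u \<ge> 0"
    proof (cases "u = \<omega>")
      case True
      then show ?thesis using l by (simp add: p_def r_def)
    next
      case False
      then show ?thesis using deg[OF False] k by (auto simp: p_def a_def b_def)
    qed
    have "(\<Sum>v\<in>Chi E u. p k v) = (\<Sum>v\<in>Chi E u. a k + b k * excess v)"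
      by (rule sum.cong) (auto simp: p_def mem_Chi child_not_root)
    also have "\<dots> = a k * real (deg E u) + b k * excess u" by (rule sum_affine_excess_Chi)
    also have "\<dots> = (real (deg E u))\<^sup>2 * (t k * p k u)"
    proof (cases "u = \<omega>")
      case True
      then have "real (deg E u) = l" "excess u = l - 1" by (simp_all add: l_def excess_def)
      then show ?thesis using k l True
        by (auto simp: a_def b_def t_def p_def r_def) (simp_all add: field_simps)
    next
      case False
      have "real (deg E u) = excess u + 1" by (simp add: excess_def)
      then show ?thesis using deg[OF False] k False
        by (auto simp: a_def b_def t_def p_def)
    qed
    finally show "(\<Sum>v\<in>Chi E u. p k v) = (real (deg E u))\<^sup>2 * (t k * p k u)" .
  next
    fix u
    have "r 0 + r 1 + r 2 = 1"
      using l by (simp add: r_def divide_simps) (simp add: power2_eq_square algebra_simps)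
    then show "(\<Sum>k<3. p k u) = 1"
      by (simp add: p_def a_def b_def numeral_3_eq_3 numeral_2_eq_2)
  qed
qed

lemma kernel_condition_adjacency_iff: "kernel_condition (adjacency_op E) \<longleftrightarrow> deg E \<omega> = 1"
proof
  assume l: "deg E \<omega> = 1"
  have "deg E u = 1" for u by (rule deg_eq_1_of_root[OF l])
  then show "kernel_condition (adjacency_op E)"
    by (auto simp: kernel_condition_def adjacency_star_adjacency diag_op_def)
next
  assume K: "kernel_condition (adjacency_op E)"
  show "deg E \<omega> = 1"
  proof (rule ccontr)
    assume "deg E \<omega> \<noteq> 1"
    then have l: "deg E \<omega> \<ge> 2" using deg_pos[of \<omega>] by simp
    have "\<exists>a\<in>Chi E \<omega>. deg E a \<noteq> 1"
    proof (rule ccontr)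
      assume "\<not> ?thesis"
      then have "excess v = 0" if "v \<in> Chi E \<omega>" for v using that by (auto simp: excess_def)
      then have "excess \<omega> = 0" using sum_excess_Chi[of \<omega>] by simp
      then show False using l by (simp add: excess_def)
    qed
    then obtain a where a: "a \<in> Chi E \<omega>" "deg E a \<noteq> 1" by blast
    have "\<exists>b\<in>Chi E \<omega>. deg E b = 1"
    proof (rule ccontr)
      assume n: "\<not> ?thesis"
      have "excess v \<ge> 1" if "v \<in> Chi E \<omega>" for v
        using n that deg_pos[of v] by (force simp: excess_def)
      then have "real (card (Chi E \<omega>)) * 1 \<le> (\<Sum>v\<in>Chi E \<omega>. excess v)"
        by (intro sum_bounded_below)
      then show False by (simp add: sum_excess_Chi) (simp add: excess_def deg_def)
    qed
    then obtain b where b: "b \<in> Chi E \<omega>" "deg E b = 1" by blast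
    have ab: "a \<noteq> b" using a b by auto
    define f where "f = (\<lambda>v. ell2_unit a v - ell2_unit b v)"
    have f: "f \<in> ell2" unfolding f_def by (intro ell2_diff) simp_all
    have sum: "(\<Sum>v\<in>Chi E u. h v * f v) = (if u = \<omega> then h a - h b else 0)" for u and h :: "'v \<Rightarrow> complex"
    proof (cases "u = \<omega>")
      case True
      have "(\<Sum>v\<in>Chi E \<omega>. h v * f v) = (\<Sum>v\<in>{a, b}. h v * f v)"
        by (rule sum.mono_neutral_right) (use a b in \<open>auto simp: f_def ell2_unit_def\<close>)
      then show ?thesis using True ab by (simp add: f_def ell2_unit_def)
    next
      case False
      then have "a \<notin> Chi E u" "b \<notin> Chi E u" using a b par_unique by (auto simp: mem_Chi)
      then show ?thesis using False by (auto simp: f_def ell2_unit_def intro!: sum.neutral)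
    qed
    have "adj (adjacency_op E) f = (\<lambda>x. 0)"
      using sum[of "\<lambda>v. 1"] by (auto simp: adj_adjacency[OF f] coshift_def)
    then have "adj (adjacency_op E) (adj (adjacency_op E) (adjacency_op E f)) = (\<lambda>x. 0)"
      using K f by (simp add: kernel_condition_def)
    then have "coshift (\<lambda>v. 1) (diag_op (\<lambda>u. real (deg E u)) f) \<omega> = 0"
      by (simp add: adjacency_star_adjacency[OF f] adj_adjacency[OF diag_deg_in[OF f]])
    then have "complex_of_nat (deg E a) = of_nat (deg E b)"
      using sum[of "\<lambda>v. of_nat (deg E v)" \<omega>] by (simp add: coshift_def diag_op_def)
    then show False using a b by simp
  qed
qed

lemma Delta_adjacency: "f \<in> ell2 \<Longrightarrow> Delta (adjacency_op E) f = diag_op excess f"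
  by (auto simp: Delta_def adjacency_star_adjacency diag_op_def excess_def algebra_simps)

lemma diag_excess_in:
  assumes "f \<in> ell2" shows "diag_op excess f \<in> ell2" "diag_op (\<lambda>u. sqrt (excess u)) f \<in> ell2"
proof -
  obtain C where C: "\<And>u. real (deg E u) \<le> C" using deg_bounded by blast
  have le: "excess u \<le> C" for u using C[of u] by (simp add: excess_def)
  show "diag_op excess f \<in> ell2"
    by (rule diag_op_ell2(1)[of _ C, OF _ assms]) (simp add: excess_nonneg le)
  show "diag_op (\<lambda>u. sqrt (excess u)) f \<in> ell2"
    by (rule diag_op_ell2(1)[of _ "sqrt C", OF _ assms]) (simp add: excess_nonneg le)
qed

lemma op_sqrt_Delta_adjacency:
  assumes "f \<in> ell2"
  shows "op_sqrt (Delta (adjacency_op E)) f = diag_op (\<lambda>u. sqrt (excess u)) f"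
proof -
  obtain C where C: "\<And>u. real (deg E u) \<le> C" using deg_bounded by blast
  have "excess u \<le> C" for u using C[of u] by (simp add: excess_def)
  then show ?thesis
    by (intro op_sqrt_diag[where C = C] assms excess_nonneg) (auto simp: op_eq_def Delta_adjacency)
qed

lemma quasi_brownian_adjacency_iff:
  "quasi_brownian (adjacency_op E) \<longleftrightarrow> (\<forall>u v. (u, v) \<in> E \<longrightarrow> deg E v = 1 \<or> deg E v = deg E u)"
proof -
  let ?T = "adjacency_op E"
  have L: "(Delta ?T \<circ> ?T) f v = (if v = \<omega> then 0 else of_real (excess v) * f (par E v))"
    if "f \<in> ell2" for f v
    using that by (simp add: Delta_adjacency adjacency_in) (simp add: diag_op_def adjacency_op_eq_wshift wshift_def)
  have R: "(op_sqrt (Delta ?T) \<circ> ?T \<circ> op_sqrt (Delta ?T)) f v =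
      (if v = \<omega> then 0 else of_real (sqrt (excess v) * sqrt (excess (par E v))) * f (par E v))"
    if "f \<in> ell2" for f v
    using that
    by (simp add: op_sqrt_Delta_adjacency diag_excess_in adjacency_in)
      (simp add: diag_op_def adjacency_op_eq_wshift wshift_def)
  have sqrt_iff: "excess v = sqrt (excess v) * sqrt (excess u) \<longleftrightarrow> deg E v = 1 \<or> deg E v = deg E u" for u v
  proof -
    have "excess v = sqrt (excess v) * sqrt (excess v)" using excess_nonneg[of v] by simp
    then have "excess v = sqrt (excess v) * sqrt (excess u) \<longleftrightarrow> excess v = 0 \<or> excess v = excess u"
      by (metis mult_cancel_left real_sqrt_eq_iff real_sqrt_eq_zero_cancel_iff)
    then show ?thesis by (simp add: excess_def)
  qed
  have "op_eq (Delta ?T \<circ> ?T) (op_sqrt (Delta ?T) \<circ> ?T \<circ> op_sqrt (Delta ?T)) \<longleftrightarrow>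
    (\<forall>u v. (u, v) \<in> E \<longrightarrow> excess v = sqrt (excess v) * sqrt (excess u))"
  proof
    assume H: "op_eq (Delta ?T \<circ> ?T) (op_sqrt (Delta ?T) \<circ> ?T \<circ> op_sqrt (Delta ?T))"
    show "\<forall>u v. (u, v) \<in> E \<longrightarrow> excess v = sqrt (excess v) * sqrt (excess u)"
    proof (intro allI impI)
      fix u v assume uv: "(u, v) \<in> E"
      have "(Delta ?T \<circ> ?T) (ell2_unit u) v = (op_sqrt (Delta ?T) \<circ> ?T \<circ> op_sqrt (Delta ?T)) (ell2_unit u) v"
        using H unfolding op_eq_def by simp
      then have "complex_of_real (excess v) = of_real (sqrt (excess v) * sqrt (excess u))"
        unfolding L[OF ell2_unit_in] R[OF ell2_unit_in]
        using uv child_not_root[OF uv] by (simp add: ell2_unit_def)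
      then show "excess v = sqrt (excess v) * sqrt (excess u)" by (simp only: of_real_eq_iff)
    qed
  next
    assume H: "\<forall>u v. (u, v) \<in> E \<longrightarrow> excess v = sqrt (excess v) * sqrt (excess u)"
    show "op_eq (Delta ?T \<circ> ?T) (op_sqrt (Delta ?T) \<circ> ?T \<circ> op_sqrt (Delta ?T))"
      unfolding op_eq_def
    proof (intro ballI ext)
      fix f :: "'v \<Rightarrow> complex" and v assume f: "f \<in> ell2"
      show "(Delta ?T \<circ> ?T) f v = (op_sqrt (Delta ?T) \<circ> ?T \<circ> op_sqrt (Delta ?T)) f v"
        unfolding L[OF f] R[OF f] using H par_edge[of v] by metis
    qed
  qed
  then show ?thesis using two_isometry by (simp add: quasi_brownian_def sqrt_iff)
qed

lemma brownian_adjacency_iff: "brownian (adjacency_op E) \<longleftrightarrow> deg E \<omega> = 1"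
proof -
  let ?T = "adjacency_op E"
  define D where "D f = (\<lambda>x. ?T (adj ?T f) x - f x)" for f
  have Din: "D f \<in> ell2" if "f \<in> ell2" for f
    unfolding D_def using that bounded_op_in[OF adjoint_pairD(2)[OF adjoint_pair_adjacency]]
    by (intro ell2_diff adjacency_in) (simp_all add: adj_adjacency)
  have eq: "(Delta ?T \<circ> D \<circ> Delta ?T) f = diag_op excess (D (diag_op excess f))" if "f \<in> ell2" for f
    using that by (simp add: Delta_adjacency Din diag_excess_in)
  have iff: "brownian ?T \<longleftrightarrow> (\<forall>f\<in>ell2. diag_op excess (D (diag_op excess f)) = (\<lambda>x. 0))"
    using two_isometry eq unfolding brownian_def op_eq_def D_def[symmetric] by auto
  show ?thesis
  proof
    assume "brownian ?T"
    then have "diag_op excess (D (diag_op excess (ell2_unit \<omega>))) \<omega> = 0"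
      unfolding iff by simp
    then have "excess \<omega> = 0"
      by (simp add: D_def diag_op_def adjacency_op_eq_wshift wshift_def ell2_unit_def)
    then show "deg E \<omega> = 1" by (simp add: excess_def)
  next
    assume l: "deg E \<omega> = 1"
    have "excess u = 0" for u using deg_eq_1_of_root[OF l, of u] by (simp add: excess_def)
    then show "brownian ?T" unfolding iff by (simp add: diag_op_def)
  qed
qed

lemma quasi_brownian_one_or_root_degree:
  assumes "\<And>u. u \<noteq> \<omega> \<Longrightarrow> deg E u = 1 \<or> deg E u = deg E \<omega>"
  shows "quasi_brownian (adjacency_op E)"
  unfolding quasi_brownian_adjacency_iff
proof (intro allI impI)
  fix u v assume uv: "(u, v) \<in> E"
  show "deg E v = 1 \<or> deg E v = deg E u"
    using assms[OF child_not_root[OF uv]] assms[of u] deg_child_le[OF uv] deg_pos[of v]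
    by (cases "u = \<omega>") auto
qed

lemma quasi_brownian_children_degree_2_iff:
  assumes "deg E \<omega> \<ge> 2" "card {v \<in> Chi E \<omega>. deg E v = 2} = deg E \<omega> - 1"
  shows "quasi_brownian (adjacency_op E) \<longleftrightarrow> deg E \<omega> = 2"
proof
  assume Q: "quasi_brownian (adjacency_op E)"
  have "card {v \<in> Chi E \<omega>. deg E v = 2} \<noteq> 0" using assms by simp
  then have "{v \<in> Chi E \<omega>. deg E v = 2} \<noteq> {}" by (metis card.empty)
  then obtain v where "(\<omega>, v) \<in> E" "deg E v = 2" by (auto simp: mem_Chi)
  then show "deg E \<omega> = 2" using Q unfolding quasi_brownian_adjacency_iff by force
next
  assume "deg E \<omega> = 2"
  then show "quasi_brownian (adjacency_op E)"
    using nonroot_degrees[OF assms] by (intro quasi_brownian_one_or_root_degree) auto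
qed

end

theorem mainTheorem19:
  fixes E :: "('v \<times> 'v) set" and \<omega> :: 'v
  assumes "directed_tree E"
    and "is_root E \<omega>"
    and "leafless E"
    and "locally_finite E"
    and "bounded_op (adjacency_op E)"
    and "two_isometry (adjacency_op E)"
    and "(\<forall>u. u \<noteq> \<omega> \<longrightarrow> deg E u = 1 \<or> deg E u = deg E \<omega>) \<or>
         (deg E \<omega> \<ge> 2 \<and> card {v \<in> Chi E \<omega>. deg E v = 2} = deg E \<omega> - 1)"
  shows "(subnormal (cauchy_dual (adjacency_op E)) \<and> contraction (cauchy_dual (adjacency_op E))) \<and>
         (kernel_condition (adjacency_op E) \<longleftrightarrow> deg E \<omega> = 1) \<and>
         ((\<forall>u. u \<noteq> \<omega> \<longrightarrow> deg E u = 1 \<or> deg E u = deg E \<omega>) \<longrightarrow>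
           quasi_brownian (adjacency_op E) \<and> (brownian (adjacency_op E) \<longleftrightarrow> deg E \<omega> = 1)) \<and>
         (deg E \<omega> \<ge> 2 \<and> card {v \<in> Chi E \<omega>. deg E v = 2} = deg E \<omega> - 1 \<longrightarrow>
           \<not> brownian (adjacency_op E) \<and> (quasi_brownian (adjacency_op E) \<longleftrightarrow> deg E \<omega> = 2))"
proof -
  interpret two_isometric_tree E \<omega>
    using assms by unfold_locales
  have "subnormal (cauchy_dual (adjacency_op E))"
    using assms(7) subnormal_cauchy_dual_one_or_root_degree subnormal_cauchy_dual_children_degree_2 by blast
  then show ?thesis
    using contraction_cauchy_dual kernel_condition_adjacency_iff brownian_adjacency_iff
      quasi_brownian_one_or_root_degree quasi_brownian_children_degree_2_iff
    by (intro conjI impI) auto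
qed

end
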